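(* Let $c\ge 3$ be an integer and let $L$ be the twist knot with crossing number $c$. Let $q(L)$ be the minimal quandle order of $L$. \begin{enumerate} \item[(1)] $q(L)=3$ if and only if $c\equiv 0\pmod 3$. In this case $(\mathbb{Z}_3,{}_1*_1)$ gives the minimal quandle order. \item[(2)] $q(L)=4$ if and only if $c=12q+r$ for some $r\in\{4,7,8,11\}$ and some non-negative integer $q$. In this case the tetrahedron quandle gives the minimal quandle order. \item[(3)] $q(L)=5$ if and only if $c=10(6q+r)+s$ for some non-negative integers $q,r,s$ with $(r,s)\in\{1,3\}\times\{4,7\}$ or $(r,s)\in\{2,4\}\times\{6,9\}$. Moreover, in this case, when $s\in\{4,9\}$ (resp. $s\in\{6,7\}$), $(\mathbb{Z}_5,{}_1*_1)$ (resp. $(\mathbb{Z}_5,{}_1*_2)$) gives the minimal quandle order. \item[(4)] $q(L)=7$ if and only if $c=14(30q+r)+s$ for some non-negative integers $q,r,s$ with $(r,s)$ belonging to one of the sets $\{0,4,10,12,22,24\}\times\{5\}$, $\{1,3,13,15,21,25\}\times\{11\}$, $\{4,8,14,16,26,28\}\times\{6\}$, $\{5,7,13,17,23,25\}\times\{0,3\}$, $\{5,7,17,19,25,29\}\times\{12\}$. Moreover, in this case, when $s\in\{5,12\}$ (resp. $s\in\{0,3\}$, resp. $s\in\{6,11\}$), $(\mathbb{Z}_7,{}_1*_1)$ (resp. $(\mathbb{Z}_7,{}_1*_2)$, resp. $(\mathbb{Z}_7,{}_1*_3)$) gives the minimal quandle order. \item[(5)] $q(L)\ge 8$ otherwise.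 \end{enumerate}
   Context: A quandle is a non-empty set $Q$ with a binary operation $*$ such that: (1) $a*a=a$ for all $a\in Q$; (2) for all $a,b\in Q$ there is a unique $c\in Q$ with $c*b=a$; (3) $(a*b)*c=(a*c)*(b*c)$ for all $a,b,c\in Q$. The order of $Q$ is its cardinality. Let $D$ be a diagram of an oriented link $L$ in $S^3$. Cutting $D$ at its undercrossing points yields arcs called strands; $\mathcal{S}(D)$ is the set of strands. For a finite quandle $Q$, a quandle coloring of $D$ by $Q$ is a map $\psi:\mathcal{S}(D)\to Q$ such that at every crossing $\psi(t)*\psi(s)=\psi(u)$, where $s$ is the over-strand and $t$, $u$ are the under-strands lying on the right-hand side and on the left-hand side of $s$ respectively (with respect to the orientation of $s$). A coloring is trivial if it is constant. $L$ is $Q$-colorable if $D$ admits a non-trivial quandle coloring by $Q$; this is independent of the diagram. The minimal quandle order of a knot $L$ is $q(L)=\min\{\,|Q| : Q \text{ a finite quandle such that } L \text{ is } Q\text{-colorable}\,\}$. A quandle $Q$ gives the minimal quandle order of $L$ if $L$ is $Q$-colorable and $|Q|=q(L)$. For an integer $n>1$ and positive integers $k,\ell$ coprime with $n$, $(\mathbb{Z}_n,{}_{\ell}*_k)$ is the quandle on $\mathbb{Z}_n$ with operation $a\,{}_{\ell}*_k\,b=((\ell+k)b-\ell a)\overline{k}$, where $\overline{k}\in\mathbb{Z}_n$ satisfies $\overline{k}k=1$. The tetrahedron quandle $S_4$ is the four-element quandle $\mathbb{Z}_2[t,t^{-1}]/(t^2+t+1)$ with operation $a*b=ta+(1-t)b$.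 The twist knot with crossing number $c\ge 3$ is the knot given by the standard alternating diagram with $c$ crossings consisting of a clasp (two crossings) together with a row of $c-2$ half-twist crossings, i.e. the two-bridge knot with Conway notation $[c-2\ \ 2]$ (e.g. $c=3$: trefoil, $c=4$: figure-eight knot, $c=5$: $5_2$). *)

theory Defs
  imports
    "HOL-Library.Z2"
    "HOL-Computational_Algebra.Polynomial"
    "HOL-Number_Theory.Number_Theory"
begin

section \<open>Quandles\<close>

definition quandle :: "'a set \<Rightarrow> ('a \<Rightarrow> 'a \<Rightarrow> 'a) \<Rightarrow> bool" where
  "quandle Q f \<longleftrightarrow>
     Q \<noteq> {} \<and>
     (\<forall>a\<in>Q. \<forall>b\<in>Q. f a b \<in> Q) \<and>
     (\<forall>a\<in>Q. f a a = a) \<and>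
     (\<forall>a\<in>Q. \<forall>b\<in>Q. \<exists>!c. c \<in> Q \<and> f c b = a) \<and>
     (\<forall>a\<in>Q. \<forall>b\<in>Q. \<forall>c\<in>Q. f (f a b) c = f (f a c) (f b c))"

text \<open>The quandle on the residues modulo \<open>n\<close>, represented by \<open>0, \<dots>, n - 1\<close>, with
  operation \<open>a * b = ((l + k) b - l a) / k\<close>.\<close>

definition Zn_carrier :: "int \<Rightarrow> int set" where
  "Zn_carrier n = {0..<n}"

definition Zn_op :: "int \<Rightarrow> int \<Rightarrow> int \<Rightarrow> int \<Rightarrow> int \<Rightarrow> int" where
  "Zn_op n l k a b = (((l + k) * b - l * a) * modular_inverse n k) mod n"

text \<open>The tetrahedron quandle. Since \<open>t (t + 1) = 1\<close> modulo \<open>t\<^sup>2 + t + 1\<close> over the field with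
  two elements, \<open>t\<close> is already invertible in the quotient of the ordinary polynomial ring, which
  is therefore the quotient of the Laurent polynomial ring as well; residue classes are
  represented by their remainders of degree less than 2.\<close>

definition S4_carrier :: "bit poly set" where
  "S4_carrier = {p. degree p < 2}"

definition S4_op :: "bit poly \<Rightarrow> bit poly \<Rightarrow> bit poly" where
  "S4_op a b = ([:0, 1:] * a + (1 - [:0, 1:]) * b) mod [:1, 1, 1:]"


section \<open>Diagrams and their quandle colorings\<close>

text \<open>A crossing lists the labels of the four edges meeting there in counterclockwise order,
  starting with an edge of the over-strand, so that over- and under-edges alternate. An
  (unoriented) diagram is the list of its crossings; an edge label occurs twice in total, at the
  two ends of the edge. Planarity plays no role in the notion of coloring and is not imposed here;
  the twist knot diagrams below are planar.\<close>

datatype 'e crossing = Crossing 'e 'e 'e 'e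

text \<open>An oriented crossing lists its edges counterclockwise starting with the incoming over-edge.
  The second edge then lies to the right of the over-strand and the fourth to its left. The flag
  tells whether the under-strand runs from right to left (a positive crossing) or from left to
  right (a negative one).\<close>

datatype 'e ocrossing =
  OCrossing (over_in: 'e) (under_right: 'e) (over_out: 'e) (under_left: 'e) (positive: bool)

definition under_in :: "'e ocrossing \<Rightarrow> 'e" where
  "under_in x = (if positive x then under_right x else under_left x)"

definition under_out :: "'e ocrossing \<Rightarrow> 'e" where
  "under_out x = (if positive x then under_left x else under_right x)"

text \<open>Every edge runs from exactly one crossing end to exactly one crossing end.\<close>

definition oriented_diagram :: "'e ocrossing list \<Rightarrow> bool" where
  "oriented_diagram D \<longleftrightarrow>
     distinct (concat (map (\<lambda>x. [over_in x, under_in x]) D)) \<and>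
     distinct (concat (map (\<lambda>x. [over_out x, under_out x]) D)) \<and>
     set (concat (map (\<lambda>x. [over_in x, under_in x]) D)) =
       set (concat (map (\<lambda>x. [over_out x, under_out x]) D))"

fun orients_crossing :: "'e crossing \<Rightarrow> 'e ocrossing \<Rightarrow> bool" where
  "orients_crossing (Crossing e f g h) (OCrossing oi r oo l s) \<longleftrightarrow>
     (oi, r, oo, l) = (e, f, g, h) \<or> (oi, r, oo, l) = (g, h, e, f)"

definition orientation_of :: "'e crossing list \<Rightarrow> 'e ocrossing list \<Rightarrow> bool" where
  "orientation_of U D \<longleftrightarrow> list_all2 orients_crossing U D \<and> oriented_diagram D"

text \<open>The diagram of the mirror image: over- and under-strand are exchanged at every crossing.\<close>

fun mirror_crossing :: "'e crossing \<Rightarrow> 'e crossing" where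
  "mirror_crossing (Crossing e f g h) = Crossing f g h e"

definition edges :: "'e ocrossing list \<Rightarrow> 'e set" where
  "edges D = (\<Union>x\<in>set D. {over_in x, over_out x, under_right x, under_left x})"

text \<open>Cutting only at the undercrossings leaves the two over-edges of each crossing joined: the
  strands are the classes of edges under the equivalence relation generated by this.\<close>

definition strand_rel :: "'e ocrossing list \<Rightarrow> ('e \<times> 'e) set" where
  "strand_rel D = ((\<Union>x\<in>set D. {(over_in x, over_out x), (over_out x, over_in x)})\<^sup>*)"

definition strands :: "'e ocrossing list \<Rightarrow> 'e set set" where
  "strands D = edges D // strand_rel D"

definition strand_of :: "'e ocrossing list \<Rightarrow> 'e \<Rightarrow> 'e set" where
  "strand_of D e = strand_rel D `` {e}"

definition quandle_coloring ::
  "'a set \<Rightarrow> ('a \<Rightarrow> 'a \<Rightarrow> 'a) \<Rightarrow> 'e ocrossing list \<Rightarrow> ('e set \<Rightarrow> 'a) \<Rightarrow> bool" where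
  "quandle_coloring Q f D \<psi> \<longleftrightarrow>
     (\<forall>s\<in>strands D. \<psi> s \<in> Q) \<and>
     (\<forall>x\<in>set D. f (\<psi> (strand_of D (under_right x))) (\<psi> (strand_of D (over_in x)))
                  = \<psi> (strand_of D (under_left x)))"

definition trivial_coloring :: "'e ocrossing list \<Rightarrow> ('e set \<Rightarrow> 'a) \<Rightarrow> bool" where
  "trivial_coloring D \<psi> \<longleftrightarrow> (\<exists>a. \<forall>s\<in>strands D. \<psi> s = a)"

definition colorable :: "'a set \<Rightarrow> ('a \<Rightarrow> 'a \<Rightarrow> 'a) \<Rightarrow> 'e ocrossing list \<Rightarrow> bool" where
  "colorable Q f D \<longleftrightarrow> (\<exists>\<psi>. quandle_coloring Q f D \<psi> \<and> \<not> trivial_coloring D \<psi>)"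

text \<open>Every finite quandle is isomorphic to one whose carrier is a finite set of natural numbers,
  so it suffices to let the minimum range over these.\<close>

definition min_quandle_order :: "'e ocrossing list \<Rightarrow> nat" where
  "min_quandle_order D =
     (LEAST m. \<exists>(Q :: nat set) f. quandle Q f \<and> finite Q \<and> colorable Q f D \<and> card Q = m)"

definition gives_min_quandle_order ::
  "'a set \<Rightarrow> ('a \<Rightarrow> 'a \<Rightarrow> 'a) \<Rightarrow> 'e ocrossing list \<Rightarrow> bool" where
  "gives_min_quandle_order Q f D \<longleftrightarrow>
     quandle Q f \<and> finite Q \<and> colorable Q f D \<and> card Q = min_quandle_order D"


section \<open>Twist knots\<close>

text \<open>The half-twists form a horizontal row of \<open>n = c - 2\<close> crossings. \<open>Top i\<close> and \<open>Bot i\<close> are the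
  upper and the lower edge between the \<open>i\<close>-th and the next crossing of the row; \<open>Top 0\<close>, \<open>Bot 0\<close>
  leave the row on the left and \<open>Top n\<close>, \<open>Bot n\<close> on the right. The clasp lies above the row and
  consists of two crossings one above the other, which bound a bigon with left side \<open>ClaspL\<close> and
  right side \<open>ClaspR\<close>. The inner edges \<open>Top 0\<close>, \<open>Top n\<close> run to the lower left and right corner of
  the lower clasp crossing, the outer edges \<open>Bot 0\<close>, \<open>Bot n\<close> to the upper left and right corner
  of the upper one. At every crossing the edges are listed in the order lower left, lower right,
  upper right, upper left, and the over-strand is the one rising to the right; this makes the
  diagram alternating.\<close>

datatype twist_edge = Top nat | Bot nat | ClaspL | ClaspR

definition twist_row :: "nat \<Rightarrow> twist_edge crossing list" where
  "twist_row n = map (\<lambda>i. Crossing (Bot i) (Bot (Suc i)) (Top (Suc i)) (Top i)) [0..<n]"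

definition twist_clasp :: "nat \<Rightarrow> twist_edge crossing list" where
  "twist_clasp n =
     [Crossing ClaspL ClaspR (Bot n) (Bot 0), Crossing (Top 0) (Top n) ClaspR ClaspL]"

definition twist_diagram :: "nat \<Rightarrow> twist_edge crossing list" where
  "twist_diagram c = twist_row (c - 2) @ twist_clasp (c - 2)"

text \<open>The knot is given by its standard diagram, on which colorability is evaluated (it does not
  depend on the choice of the diagram). Both chiralities and both orientations are admitted.\<close>

definition twist_knot :: "nat \<Rightarrow> twist_edge ocrossing list \<Rightarrow> bool" where
  "twist_knot c L \<longleftrightarrow>
     orientation_of (twist_diagram c) L \<or>
     orientation_of (map mirror_crossing (twist_diagram c)) L"

text \<open>An orientation of the standard diagram. The two strands run through the row in opposite
  directions.\<close>

definition twist_row_oriented :: "nat \<Rightarrow> twist_edge ocrossing list" where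
  "twist_row_oriented n =
     map (\<lambda>i. if even i then OCrossing (Top (Suc i)) (Top i) (Bot i) (Bot (Suc i)) True
              else OCrossing (Bot i) (Bot (Suc i)) (Top (Suc i)) (Top i) True) [0..<n]"

definition twist_clasp_oriented :: "nat \<Rightarrow> twist_edge ocrossing list" where
  "twist_clasp_oriented n =
     [if even n then OCrossing ClaspL ClaspR (Bot n) (Bot 0) False
      else OCrossing (Bot n) (Bot 0) ClaspL ClaspR True,
      OCrossing ClaspR ClaspL (Top 0) (Top n) (odd n)]"

lemma twist_row_oriented_heads:
  "distinct (concat (map (\<lambda>x. [over_in x, under_in x]) (twist_row_oriented n)))
   \<and> set (concat (map (\<lambda>x. [over_in x, under_in x]) (twist_row_oriented n)))
     = Top ` {..<if even n then n else Suc n} \<union> Bot ` {1..<if even n then Suc n else n}"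
proof (induction n)
  case 0
  show ?case by (simp add: twist_row_oriented_def)
next
  case (Suc n)
  have row: "twist_row_oriented (Suc n) = twist_row_oriented n @
    [if even n then OCrossing (Top (Suc n)) (Top n) (Bot n) (Bot (Suc n)) True
     else OCrossing (Bot n) (Bot (Suc n)) (Top (Suc n)) (Top n) True]"
    by (simp add: twist_row_oriented_def)
  show ?case
  proof (cases "even n")
    case True
    then show ?thesis
      unfolding row map_append concat_append distinct_append set_append conjunct2[OF Suc]
      using conjunct1[OF Suc] by (simp add: under_in_def image_iff lessThan_Suc insert_commute)
  next
    case False
    then have "1 \<le> n" by (cases n) simp_all
    with False show ?thesis
      unfolding row map_append concat_append distinct_append set_append conjunct2[OF Suc]
      using conjunct1[OF Suc]
      by (simp add: under_in_def image_iff atLeastLessThanSuc insert_commute)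
  qed
qed

lemma twist_row_oriented_tails:
  "distinct (concat (map (\<lambda>x. [over_out x, under_out x]) (twist_row_oriented n)))
   \<and> set (concat (map (\<lambda>x. [over_out x, under_out x]) (twist_row_oriented n)))
     = Bot ` {..<if even n then n else Suc n} \<union> Top ` {1..<if even n then Suc n else n}"
proof (induction n)
  case 0
  show ?case by (simp add: twist_row_oriented_def)
next
  case (Suc n)
  have row: "twist_row_oriented (Suc n) = twist_row_oriented n @
    [if even n then OCrossing (Top (Suc n)) (Top n) (Bot n) (Bot (Suc n)) True
     else OCrossing (Bot n) (Bot (Suc n)) (Top (Suc n)) (Top n) True]"
    by (simp add: twist_row_oriented_def)
  show ?case
  proof (cases "even n")
    case True
    then show ?thesis
      unfolding row map_append concat_append distinct_append set_append conjunct2[OF Suc]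
      using conjunct1[OF Suc] by (simp add: under_out_def image_iff lessThan_Suc insert_commute)
  next
    case False
    then have "1 \<le> n" by (cases n) simp_all
    with False show ?thesis
      unfolding row map_append concat_append distinct_append set_append conjunct2[OF Suc]
      using conjunct1[OF Suc]
      by (simp add: under_out_def image_iff atLeastLessThanSuc insert_commute)
  qed
qed

lemma twist_oriented_diagram:
  assumes "n > 0"
  shows "oriented_diagram (twist_row_oriented n @ twist_clasp_oriented n)"
proof -
  let ?heads = "\<lambda>D. concat (map (\<lambda>x. [over_in x, under_in x]) D) :: twist_edge list"
  let ?tails = "\<lambda>D. concat (map (\<lambda>x. [over_out x, under_out x]) D) :: twist_edge list"
  let ?R = "twist_row_oriented n" and ?C = "twist_clasp_oriented n"
  let ?E = "Top ` {..n} \<union> Bot ` {..n} \<union> {ClaspL, ClaspR}"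
  have clasp:
    "?heads ?C = (if even n then [ClaspL, Bot 0, ClaspR, Top n] else [Bot n, Bot 0, ClaspR, ClaspL])"
    "?tails ?C = (if even n then [Bot n, ClaspR, Top 0, ClaspL] else [ClaspL, ClaspR, Top 0, Top n])"
    by (simp_all add: twist_clasp_oriented_def under_in_def under_out_def)
  have below: "{..n} = insert 0 {1..<Suc n}" "{..n} = insert n {..<n}" "{..n} = {..<Suc n}"
    "{..n} = insert 0 (insert n {1..<n})"
    using assms by auto
  have dist: "distinct (?heads ?R @ ?heads ?C)" "distinct (?tails ?R @ ?tails ?C)"
    unfolding distinct_append clasp conjunct2[OF twist_row_oriented_heads]
      conjunct2[OF twist_row_oriented_tails]
    using twist_row_oriented_heads[of n] twist_row_oriented_tails[of n] assms
    by (simp_all add: image_iff)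
  have sets: "set (?heads ?R @ ?heads ?C) = ?E \<and> set (?tails ?R @ ?tails ?C) = ?E"
  proof (cases "even n")
    case True
    have "?E = Top ` insert n {..<n} \<union> Bot ` insert 0 {1..<Suc n} \<union> {ClaspL, ClaspR}"
      "?E = Top ` insert 0 {1..<Suc n} \<union> Bot ` insert n {..<n} \<union> {ClaspL, ClaspR}"
      using below(1,2) by (simp_all only:)
    with True show ?thesis
      unfolding set_append conjunct2[OF twist_row_oriented_heads]
        conjunct2[OF twist_row_oriented_tails] clasp
      by (simp only: if_True) (simp, blast)
  next
    case False
    have "?E = Top ` {..<Suc n} \<union> Bot ` insert 0 (insert n {1..<n}) \<union> {ClaspL, ClaspR}"
      "?E = Top ` insert 0 (insert n {1..<n}) \<union> Bot ` {..<Suc n} \<union> {ClaspL, ClaspR}"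
      using below(3,4) by (simp_all only:)
    with False show ?thesis
      unfolding set_append conjunct2[OF twist_row_oriented_heads]
        conjunct2[OF twist_row_oriented_tails] clasp
      by (simp only: if_False) (simp, blast)
  qed
  show ?thesis
    using dist sets unfolding oriented_diagram_def map_append concat_append by simp
qed

lemma twist_knot_exists:
  assumes "c \<ge> 3"
  shows "\<exists>L. twist_knot c L"
proof -
  have "list_all2 orients_crossing (twist_diagram c)
          (twist_row_oriented (c - 2) @ twist_clasp_oriented (c - 2))"
    unfolding twist_diagram_def twist_row_def twist_row_oriented_def twist_clasp_def
      twist_clasp_oriented_def
    by (intro list_all2_appendI) (simp_all add: list.rel_map list.rel_refl_strong)
  moreover have "oriented_diagram (twist_row_oriented (c - 2) @ twist_clasp_oriented (c - 2))"
    using assms by (intro twist_oriented_diagram) auto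
  ultimately show ?thesis
    unfolding twist_knot_def orientation_of_def by blast
qed


section \<open>Exceptional residues\<close>

definition residues5 :: "(nat \<times> nat) set" where
  "residues5 = {1, 3} \<times> {4, 7} \<union> {2, 4} \<times> {6, 9}"

definition residues7 :: "(nat \<times> nat) set" where
  "residues7 =
     {0, 4, 10, 12, 22, 24} \<times> {5} \<union>
     {1, 3, 13, 15, 21, 25} \<times> {11} \<union>
     {4, 8, 14, 16, 26, 28} \<times> {6} \<union>
     {5, 7, 13, 17, 23, 25} \<times> {0, 3} \<union>
     {5, 7, 17, 19, 25, 29} \<times> {12}"

end

theory Submission
  imports Defs
begin

text \<open>
  Put \<open>n = c - 2\<close>. A coloring of the standard diagram is a sequence \<open>z\<^sub>0, \<dots>, z\<^sub>n\<^sub>+\<^sub>1\<close> of colors of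
  the strands that one meets along the row of half-twists. Since the two strands run through the
  row in opposite directions, the crossings of the row say alternately \<open>z\<^sub>i * z\<^sub>i\<^sub>+\<^sub>1 = z\<^sub>i\<^sub>+\<^sub>2\<close>
  and \<open>z\<^sub>i\<^sub>+\<^sub>2 * z\<^sub>i\<^sub>+\<^sub>1 = z\<^sub>i\<close>; the two crossings of the clasp close the sequence up, the first
  one by \<open>z\<^sub>n\<^sub>+\<^sub>1 * z\<^sub>0 = z\<^sub>n\<close>. The mirror image and the reversed orientation yield the same
  relations, or those relations for the dual quandle (\<open>colorable_iff_twist_coloring\<close>).

  The row acts on the colors as a translation: with \<open>a = z\<^sub>0\<close> and \<open>b = z\<^sub>1\<close>, every \<open>z\<^sub>i\<^sub>+\<^sub>2\<close> is
  the image of \<open>z\<^sub>i\<close> under the automorphism \<open>x \<mapsto> (x / a) * b\<close>, where \<open>x / a\<close> is the element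
  whose product with \<open>a\<close> is \<open>x\<close> (\<open>twist_coloring_step\<close>). So the sequence is determined by \<open>a\<close>
  and \<open>b\<close>, in a finite quandle it is periodic, and whether it closes up is a condition on the
  residue of \<open>c\<close> modulo its period, which can be read off from the right multiplications by \<open>a\<close>
  and \<open>b\<close> on the subquandle that \<open>a\<close> and \<open>b\<close> generate.

  For the lower bounds on the order, all quandles with at most seven elements and two generators
  are enumerated by an exhaustive search, in the manner of the Todd--Coxeter procedure, with the
  products by the two generators as unknowns. The search is written as a function on finite
  tables and proved sound (\<open>search_sound\<close>); it is then evaluated by rewriting
  (\<open>search_complete\<close>). It shows that a nonconstant coloring by a quandle in which \<open>a\<close> and \<open>b\<close>
  generate a subquandle with \<open>m \<le> 7\<close> elements forces \<open>c\<close> into residue classes that depend on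
  \<open>m\<close>: the class \<open>0\<close> modulo \<open>3\<close> for \<open>m = 3, 6\<close>, the classes \<open>0, 3\<close> modulo \<open>4\<close> for \<open>m = 4\<close>, the
  classes \<open>4, 6, 7, 9\<close> modulo \<open>10\<close> for \<open>m = 5\<close>, and \<open>0, 3, 5, 6, 11, 12\<close> modulo \<open>14\<close> for \<open>m =
  7\<close>.

  Conversely, in an affine quandle modulo \<open>p\<close> the translation adds a constant, and the sequence
  closes up precisely when the Alexander polynomial of the twist knot, evaluated at \<open>- l / k\<close>
  and with denominators cleared, is divisible by \<open>p\<close> (\<open>affine_twist_coloring\<close>). This realizes
  all the classes modulo \<open>3\<close>, \<open>10\<close> and \<open>14\<close>; the tetrahedron quandle realizes those modulo \<open>4\<close>,
  and the dihedral quandle on \<open>2 c - 3\<close> elements shows that some finite quandle always works, so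
  that the minimum exists. The residues in the theorem are what remains of these classes once
  those of smaller quandles are removed.
\<close>

section \<open>Quandles and their duals\<close>

definition right_div :: "'a set \<Rightarrow> ('a \<Rightarrow> 'a \<Rightarrow> 'a) \<Rightarrow> 'a \<Rightarrow> 'a \<Rightarrow> 'a" where
  "right_div Q f a b = (THE c. c \<in> Q \<and> f c b = a)"

lemma quandleD:
  assumes "quandle Q f"
  shows quandle_closed: "\<And>a b. a \<in> Q \<Longrightarrow> b \<in> Q \<Longrightarrow> f a b \<in> Q"
    and quandle_idem: "\<And>a. a \<in> Q \<Longrightarrow> f a a = a"
    and quandle_distrib: "\<And>a b c. a \<in> Q \<Longrightarrow> b \<in> Q \<Longrightarrow> c \<in> Q \<Longrightarrow> f (f a b) c = f (f a c) (f b c)"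
  using assms unfolding quandle_def by metis+

lemma quandleI:
  assumes "Q \<noteq> {}"
    and "\<And>a b. a \<in> Q \<Longrightarrow> b \<in> Q \<Longrightarrow> f a b \<in> Q"
    and "\<And>a. a \<in> Q \<Longrightarrow> f a a = a"
    and "\<And>a b. a \<in> Q \<Longrightarrow> b \<in> Q \<Longrightarrow> \<exists>!c. c \<in> Q \<and> f c b = a"
    and "\<And>a b c. a \<in> Q \<Longrightarrow> b \<in> Q \<Longrightarrow> c \<in> Q \<Longrightarrow> f (f a b) c = f (f a c) (f b c)"
  shows "quandle Q f"
  unfolding quandle_def by (intro conjI ballI) (fact assms)+

lemma right_div:
  assumes "quandle Q f" "a \<in> Q" "b \<in> Q"
  shows right_div_closed: "right_div Q f a b \<in> Q"
    and right_div_mult: "f (right_div Q f a b) b = a"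
proof -
  have "\<exists>!c. c \<in> Q \<and> f c b = a"
    using assms unfolding quandle_def by blast
  from theI'[OF this] show "right_div Q f a b \<in> Q" "f (right_div Q f a b) b = a"
    unfolding right_div_def by auto
qed

lemma quandle_cancel:
  assumes "quandle Q f" "a \<in> Q" "a' \<in> Q" "b \<in> Q" "f a b = f a' b"
  shows "a = a'"
proof -
  have "f a' b \<in> Q"
    using assms quandle_closed by metis
  then have "\<exists>!c. c \<in> Q \<and> f c b = f a' b"
    using assms unfolding quandle_def by blast
  with assms show ?thesis by metis
qed

lemma right_div_eq_iff:
  assumes "quandle Q f" "a \<in> Q" "b \<in> Q" "c \<in> Q"
  shows "right_div Q f a b = c \<longleftrightarrow> f c b = a"
  using assms right_div quandle_cancel by metis

text \<open>The dual quandle governs the colorings of the mirror image and of the reversed knot.\<close>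

lemma quandle_dual:
  assumes "quandle Q f"
  shows "quandle Q (right_div Q f)"
proof (rule quandleI)
  let ?g = "right_div Q f"
  show "Q \<noteq> {}"
    using assms by (simp add: quandle_def)
  show "?g a b \<in> Q" if "a \<in> Q" "b \<in> Q" for a b
    using that by (rule right_div_closed[OF assms])
  show "?g a a = a" if "a \<in> Q" for a
    using that assms by (simp add: right_div_eq_iff quandle_idem)
  show "\<exists>!c. c \<in> Q \<and> ?g c b = a" if "a \<in> Q" "b \<in> Q" for a b
    using that assms
    by (intro ex1I[of _ "f a b"]) (auto simp: right_div_eq_iff right_div_mult quandle_closed)
  show "?g (?g a b) c = ?g (?g a c) (?g b c)" if "a \<in> Q" "b \<in> Q" "c \<in> Q" for a b c
  proof -
    let ?x = "?g (?g a c) (?g b c)"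
    have mem: "?g a c \<in> Q" "?g b c \<in> Q" "?x \<in> Q"
      using that assms by (auto intro: right_div_closed)
    have "f (f ?x c) b = f (f ?x c) (f (?g b c) c)"
      using that assms by (simp add: right_div_mult)
    also have "\<dots> = f (f ?x (?g b c)) c"
      by (rule quandle_distrib[OF assms mem(3,2) that(3), symmetric])
    also have "\<dots> = a"
      using that mem assms by (simp add: right_div_mult)
    finally have "?g a b = f ?x c"
      by (rule iffD2[OF right_div_eq_iff[OF assms that(1,2) quandle_closed[OF assms mem(3) that(3)]]])
    from this[symmetric] show ?thesis
      by (rule iffD2[OF right_div_eq_iff[OF assms right_div_closed[OF assms that(1,2)] that(3) mem(3)]])
  qed
qed

section \<open>Colorings as labelings of edges\<close>

definition edge_coloring ::
  "'a set \<Rightarrow> ('a \<Rightarrow> 'a \<Rightarrow> 'a) \<Rightarrow> 'e ocrossing list \<Rightarrow> ('e \<Rightarrow> 'a) \<Rightarrow> bool" where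
  "edge_coloring Q f D \<phi> \<longleftrightarrow> (\<forall>e\<in>edges D. \<phi> e \<in> Q) \<and>
     (\<forall>x\<in>set D. \<phi> (over_in x) = \<phi> (over_out x) \<and>
        f (\<phi> (under_right x)) (\<phi> (over_in x)) = \<phi> (under_left x))"

lemma edges_crossing:
  assumes "x \<in> set D"
  shows "over_in x \<in> edges D" "over_out x \<in> edges D" "under_right x \<in> edges D"
    "under_left x \<in> edges D"
  using assms unfolding edges_def by auto

lemma equiv_strand_rel: "equiv UNIV (strand_rel D)"
proof (rule equivI)
  show "sym (strand_rel D)"
    unfolding strand_rel_def by (intro sym_rtrancl) (auto simp: sym_def)
qed (auto simp: strand_rel_def refl_on_def intro: trans_rtrancl)

lemma over_strand: "x \<in> set D \<Longrightarrow> strand_of D (over_in x) = strand_of D (over_out x)"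
  unfolding strand_of_def
  by (rule equiv_class_eq[OF equiv_strand_rel]) (auto simp: strand_rel_def)

lemma strandE:
  assumes "s \<in> strands D"
  obtains e where "e \<in> edges D" "s = strand_of D e"
  using assms unfolding strands_def strand_of_def by (auto elim: quotientE)

lemma strand_of_in: "e \<in> edges D \<Longrightarrow> strand_of D e \<in> strands D"
  unfolding strands_def strand_of_def by (rule quotientI)

text \<open>Working with edges instead of strands avoids the quotient: an edge labeling that agrees on
  the two over-edges of every crossing is the same as a labeling of the strands.\<close>

lemma colorable_iff_edge_coloring:
  "colorable Q f D \<longleftrightarrow>
     (\<exists>\<phi>. edge_coloring Q f D \<phi> \<and> (\<exists>e\<in>edges D. \<exists>e'\<in>edges D. \<phi> e \<noteq> \<phi> e'))"
proof
  assume "colorable Q f D"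
  then obtain \<psi> where \<psi>: "quandle_coloring Q f D \<psi>" "\<not> trivial_coloring D \<psi>"
    unfolding colorable_def by blast
  have "edge_coloring Q f D (\<lambda>e. \<psi> (strand_of D e))"
    using \<psi>(1) unfolding edge_coloring_def quandle_coloring_def
    by (auto simp: over_strand strand_of_in)
  moreover have "\<exists>e\<in>edges D. \<exists>e'\<in>edges D. \<psi> (strand_of D e) \<noteq> \<psi> (strand_of D e')"
    using \<psi>(2) unfolding trivial_coloring_def by (metis strandE)
  ultimately show "\<exists>\<phi>. edge_coloring Q f D \<phi> \<and> (\<exists>e\<in>edges D. \<exists>e'\<in>edges D. \<phi> e \<noteq> \<phi> e')"
    by blast
next
  assume "\<exists>\<phi>. edge_coloring Q f D \<phi> \<and> (\<exists>e\<in>edges D. \<exists>e'\<in>edges D. \<phi> e \<noteq> \<phi> e')"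
  then obtain \<phi> e0 e1 where \<phi>: "edge_coloring Q f D \<phi>"
    and ne: "e0 \<in> edges D" "e1 \<in> edges D" "\<phi> e0 \<noteq> \<phi> e1"
    by blast
  have const: "\<phi> e = \<phi> e'" if "(e, e') \<in> strand_rel D" for e e'
    using that unfolding strand_rel_def
    by induction (use \<phi> in \<open>auto simp: edge_coloring_def\<close>)
  define \<psi> where "\<psi> s = \<phi> (SOME e. e \<in> s)" for s
  have \<psi>: "\<psi> (strand_of D e) = \<phi> e" for e
  proof -
    have "e \<in> strand_of D e"
      unfolding strand_of_def strand_rel_def by auto
    then have "(SOME e'. e' \<in> strand_of D e) \<in> strand_of D e"
      by (rule someI)
    then show ?thesis
      unfolding \<psi>_def using const by (auto simp: strand_of_def)
  qed
  have "quandle_coloring Q f D \<psi>"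
    using \<phi> unfolding quandle_coloring_def edge_coloring_def
    by (auto simp: \<psi> elim!: strandE)
  moreover have "\<not> trivial_coloring D \<psi>"
    unfolding trivial_coloring_def using ne strand_of_in \<psi> by metis
  ultimately show "colorable Q f D"
    unfolding colorable_def by blast
qed

text \<open>Transport of structure along a bijection; it serves to replace any finite carrier by a set
  of natural numbers, over which the minimum is taken.\<close>

lemma edge_coloring_iso:
  assumes "quandle Q f" "bij_betw h Q R" "edge_coloring Q f D \<phi>"
  defines "g \<equiv> \<lambda>x y. h (f (inv_into Q h x) (inv_into Q h y))"
  shows "quandle R g" "edge_coloring R g D (h \<circ> \<phi>)"
proof -
  have inj: "inj_on h Q" and R: "R = h ` Q"
    using assms(2) by (auto simp: bij_betw_def)
  have g: "g (h x) (h y) = h (f x y)" if "x \<in> Q" "y \<in> Q" for x y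
    using that inj by (simp add: g_def)
  show "quandle R g"
    unfolding R
  proof (rule quandleI; ((erule imageE)+)?; hypsubst?)
    show "h ` Q \<noteq> {}"
      using assms(1) by (simp add: quandle_def)
    fix a b assume ab: "a \<in> Q" "b \<in> Q"
    show "g (h a) (h b) \<in> h ` Q" "g (h a) (h a) = h a"
      using ab assms(1) by (simp_all add: g quandle_closed quandle_idem)
    show "\<exists>!c. c \<in> h ` Q \<and> g c (h b) = h a"
    proof (rule ex1I[of _ "h (right_div Q f a b)"])
      show "h (right_div Q f a b) \<in> h ` Q \<and> g (h (right_div Q f a b)) (h b) = h a"
        using ab assms(1) by (simp add: g right_div_closed right_div_mult)
      fix c assume c: "c \<in> h ` Q \<and> g c (h b) = h a"
      then obtain c' where c': "c = h c'" "c' \<in> Q"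
        by auto
      then have "h (f c' b) = h a"
        using c g ab by simp
      then have "f c' b = a"
        using c'(2) ab inj assms(1) by (metis inj_onD quandle_closed)
      then show "c = h (right_div Q f a b)"
        using c' ab right_div_eq_iff[OF assms(1)] by metis
    qed
    fix c assume "c \<in> Q"
    then show "g (g (h a) (h b)) (h c) = g (g (h a) (h c)) (g (h b) (h c))"
      using ab assms(1) quandle_distrib[OF assms(1) ab] by (simp add: g quandle_closed)
  qed
  show "edge_coloring R g D (h \<circ> \<phi>)"
    using assms(3) unfolding edge_coloring_def R by (auto simp: g edges_crossing)
qed

lemma colorable_by_naturals:
  assumes "quandle Q f" "finite Q" "colorable Q f D"
  shows "\<exists>(R :: nat set) g. quandle R g \<and> finite R \<and> colorable R g D \<and> card R = card Q"
proof -
  obtain \<phi> e e' where \<phi>: "edge_coloring Q f D \<phi>" "e \<in> edges D" "e' \<in> edges D" "\<phi> e \<noteq> \<phi> e'"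
    using assms(3) unfolding colorable_iff_edge_coloring by blast
  obtain h where h: "bij_betw h Q {0..<card Q}"
    using ex_bij_betw_finite_nat[OF assms(2)] by blast
  have "h (\<phi> e) \<noteq> h (\<phi> e')"
    using h \<phi> by (auto simp: bij_betw_def inj_on_def edge_coloring_def)
  then show ?thesis
    using edge_coloring_iso[OF assms(1) h \<phi>(1)] \<phi>(2,3)
    unfolding colorable_iff_edge_coloring by fastforce
qed

section \<open>Colorings of twist knots\<close>

text \<open>The two ways in which the color \<open>b\<close> of an over-strand can relate the colors of the two
  under-strands, according to the direction of the over-strand.\<close>

definition crossing_rel :: "('a \<Rightarrow> 'a \<Rightarrow> 'a) \<Rightarrow> bool \<Rightarrow> 'a \<Rightarrow> 'a \<Rightarrow> 'a \<Rightarrow> bool" where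
  "crossing_rel f d a b c \<longleftrightarrow> (if d then f a b = c else f c b = a)"

text \<open>The colors along the row of half-twists, followed by the two relations of the clasp. The
  flag \<open>d\<close> records the orientation: switching it reverses all the crossings at once, which
  amounts to passing to the dual quandle.\<close>

definition twist_coloring ::
  "'a set \<Rightarrow> ('a \<Rightarrow> 'a \<Rightarrow> 'a) \<Rightarrow> bool \<Rightarrow> nat \<Rightarrow> (nat \<Rightarrow> 'a) \<Rightarrow> bool" where
  "twist_coloring Q f d n z \<longleftrightarrow>
     (\<forall>i\<le>Suc n. z i \<in> Q) \<and>
     (\<forall>i<n. crossing_rel f (d \<longleftrightarrow> even i) (z i) (z (Suc i)) (z (Suc (Suc i)))) \<and>
     crossing_rel f d (z (Suc n)) (z 0) (z n) \<and>
     crossing_rel f (d \<longleftrightarrow> odd n) (z 1) (z (Suc n)) (z 0)"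

definition enters :: "'e \<Rightarrow> 'e ocrossing \<Rightarrow> bool" where
  "enters e x \<longleftrightarrow> e \<in> {over_in x, under_in x}"

definition leaves :: "'e \<Rightarrow> 'e ocrossing \<Rightarrow> bool" where
  "leaves e x \<longleftrightarrow> e \<in> {over_out x, under_out x}"

lemma distinct_concat_disjoint:
  assumes "distinct (concat (map g D))" "i < j" "j < length D" "e \<in> set (g (D ! i))"
  shows "e \<notin> set (g (D ! j))"
proof -
  have "D = take j D @ D ! j # drop (Suc j) D"
    using assms(3) by (rule id_take_nth_drop)
  then have "distinct (concat (map g (take j D @ D ! j # drop (Suc j) D)))"
    using assms(1) by metis
  moreover have "D ! i \<in> set (take j D)"
    using assms(2,3) by (auto simp: in_set_conv_nth intro!: exI[of _ i])
  ultimately show ?thesis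
    using assms(4) by auto
qed

lemma enters_once:
  assumes "oriented_diagram D" "i < length D" "j < length D" "i \<noteq> j" "enters e (D ! i)"
  shows "\<not> enters e (D ! j)"
  using assms distinct_concat_disjoint[of "\<lambda>x. [over_in x, under_in x]" D i j e]
    distinct_concat_disjoint[of "\<lambda>x. [over_in x, under_in x]" D j i e]
  unfolding oriented_diagram_def enters_def by (cases "i < j") auto

lemma leaves_once:
  assumes "oriented_diagram D" "i < length D" "j < length D" "i \<noteq> j" "leaves e (D ! i)"
  shows "\<not> leaves e (D ! j)"
  using assms distinct_concat_disjoint[of "\<lambda>x. [over_out x, under_out x]" D i j e]
    distinct_concat_disjoint[of "\<lambda>x. [over_out x, under_out x]" D j i e]
  unfolding oriented_diagram_def leaves_def by (cases "i < j") auto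

text \<open>The over-strand joins \<open>a\<close> and \<open>b\<close> and the under-strand joins \<open>c\<close> and \<open>d\<close>, both in an
  unspecified direction.\<close>

definition passes :: "'e ocrossing \<Rightarrow> 'e \<Rightarrow> 'e \<Rightarrow> 'e \<Rightarrow> 'e \<Rightarrow> bool" where
  "passes x a b c d \<longleftrightarrow> distinct [a, b, c, d] \<and>
     (over_in x = a \<and> over_out x = b \<or> over_in x = b \<and> over_out x = a) \<and>
     (under_in x = c \<and> under_out x = d \<or> under_in x = d \<and> under_out x = c)"

lemma passesD:
  assumes "passes x a b c d"
  shows "enters a x \<longleftrightarrow> over_in x = a" "enters b x \<longleftrightarrow> \<not> enters a x"
    "enters d x \<longleftrightarrow> \<not> enters c x"
    and "e \<in> {a, b, c, d} \<Longrightarrow> leaves e x \<longleftrightarrow> \<not> enters e x"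
  using assms unfolding passes_def enters_def leaves_def by auto

text \<open>An edge has one head and one tail, so at exactly one of its two ends it enters the
  crossing.\<close>

lemma enters_other_end:
  assumes "oriented_diagram D" "i < length D" "j < length D" "i \<noteq> j"
    and "passes (D ! i) a b c d" "e \<in> {a, b, c, d}"
    and "passes (D ! j) a' b' c' d'" "e \<in> {a', b', c', d'}"
  shows "enters e (D ! j) \<longleftrightarrow> \<not> enters e (D ! i)"
  using enters_once[OF assms(1-4)] leaves_once[OF assms(1-4)]
    passesD(4)[OF assms(5,6)] passesD(4)[OF assms(7,8)] by blast

text \<open>A twist diagram has only two orientations. Every edge passes its direction on from one
  crossing to the next, so that the direction \<open>r\<close> of the over-strand at the first crossing of
  the row spreads, by way of the clasp, to the under-strand of that crossing, which runs in the
  opposite direction, and from there along the whole row. The diagram enters only through the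
  edges that each crossing joins; this description is the same for the mirror image, with the
  roles of \<open>T\<close> and \<open>B\<close> and of the two crossings of the clasp exchanged.\<close>

lemma twist_orientation:
  fixes T B :: "nat \<Rightarrow> 'e" and CL CR :: 'e
  assumes D: "oriented_diagram D" and len: "length D = n + 2" and n: "n > 0"
    and lu: "{l, u} = {n, Suc n}"
    and row: "\<And>i. i < n \<Longrightarrow> passes (D ! i) (B i) (T (Suc i)) (T i) (B (Suc i))"
    and low: "passes (D ! l) (T 0) CR (T n) CL"
    and up: "passes (D ! u) CL (B n) CR (B 0)"
  obtains r where "\<And>i. i < n \<Longrightarrow> over_in (D ! i) = B i \<longleftrightarrow> (r \<longleftrightarrow> even i)"
    and "over_in (D ! l) = T 0 \<longleftrightarrow> r" and "over_in (D ! u) = CL \<longleftrightarrow> (r \<longleftrightarrow> odd n)"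
proof -
  define r where "r \<longleftrightarrow> enters (B 0) (D ! 0)"
  have lu': "l < length D" "u < length D" "l \<noteq> u" "u \<noteq> l" "l \<ge> n" "u \<ge> n"
    using lu len by (auto simp: doubleton_eq_iff)
  have ne: "l \<noteq> 0" "0 \<noteq> u" "n - 1 \<noteq> u" "n - 1 < length D" "0 < length D"
    using lu' n by auto
  \<comment> \<open>From the first crossing of the row through the clasp and back: \<open>B 0\<close>, \<open>CR\<close>, \<open>T 0\<close>.\<close>
  have "enters (B 0) (D ! u) \<longleftrightarrow> \<not> enters (B 0) (D ! 0)"
    by (rule enters_other_end[OF D ne(5) lu'(2) ne(2) row[OF n] _ up]) simp_all
  moreover have "enters CR (D ! l) \<longleftrightarrow> \<not> enters CR (D ! u)"
    by (rule enters_other_end[OF D lu'(2,1,4) up _ low]) simp_all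
  moreover have "enters (T 0) (D ! 0) \<longleftrightarrow> \<not> enters (T 0) (D ! l)"
    by (rule enters_other_end[OF D lu'(1) ne(5,1) low _ row[OF n]]) simp_all
  ultimately have start: "enters (T 0) (D ! l) \<longleftrightarrow> r" "enters (T 0) (D ! 0) \<longleftrightarrow> \<not> r"
    using passesD(2)[OF low] passesD(3)[OF up] unfolding r_def by blast+
  have along: "(enters (B i) (D ! i) \<longleftrightarrow> (r \<longleftrightarrow> even i)) \<and> (enters (T i) (D ! i) \<longleftrightarrow> (r \<longleftrightarrow> odd i))"
    if "i < n" for i
    using that
  proof (induction i)
    case 0
    show ?case using start(2) r_def by simp
  next
    case (Suc i)
    then have i: "i < n" "i < length D" "Suc i < length D" "i \<noteq> Suc i"
      using len by auto
    have "enters (B (Suc i)) (D ! Suc i) \<longleftrightarrow> \<not> enters (B (Suc i)) (D ! i)"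
      by (rule enters_other_end[OF D i(2-4) row[OF i(1)] _ row[OF Suc.prems]]) simp_all
    moreover have "enters (T (Suc i)) (D ! Suc i) \<longleftrightarrow> \<not> enters (T (Suc i)) (D ! i)"
      by (rule enters_other_end[OF D i(2-4) row[OF i(1)] _ row[OF Suc.prems]]) simp_all
    ultimately show ?case
      using Suc.IH[OF i(1)] passesD(2,3)[OF row[OF i(1)]] by simp
  qed
  have m: "n - 1 < n" "Suc (n - 1) = n" "even (n - 1) \<longleftrightarrow> odd n"
    using n by auto
  have "enters (B n) (D ! u) \<longleftrightarrow> \<not> enters (B n) (D ! (n - 1))"
    by (rule enters_other_end[OF D ne(4) lu'(2) ne(3) row[OF m(1)] _ up]) (use m(2) in simp_all)
  then have "enters CL (D ! u) \<longleftrightarrow> (r \<longleftrightarrow> odd n)"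
    using along[OF m(1)] passesD(3)[OF row[OF m(1)]] passesD(2)[OF up] m(2,3) by simp
  then show ?thesis
    using start(1) along
    by (intro that[of r]) (auto simp: passesD(1)[OF row, symmetric] passesD(1)[OF low, symmetric]
        passesD(1)[OF up, symmetric])
qed

definition colored :: "('a \<Rightarrow> 'a \<Rightarrow> 'a) \<Rightarrow> ('e \<Rightarrow> 'a) \<Rightarrow> 'e ocrossing \<Rightarrow> bool" where
  "colored f \<phi> x \<longleftrightarrow> \<phi> (over_in x) = \<phi> (over_out x) \<and>
     f (\<phi> (under_right x)) (\<phi> (over_in x)) = \<phi> (under_left x)"

lemma orients_crossingD:
  assumes "orients_crossing (Crossing e f g h) x" "distinct [e, f, g, h]"
  shows "passes x e g f h" "passes x e g h f" "passes x g e f h" "passes x g e h f"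
    and "colored F \<phi> x \<longleftrightarrow> \<phi> e = \<phi> g \<and>
      crossing_rel F (over_in x = e) (\<phi> f) (\<phi> e) (\<phi> h)"
    and "over_in x = g \<longleftrightarrow> over_in x \<noteq> e"
  using assms
  by (cases x; auto simp: crossing_rel_def passes_def colored_def under_in_def under_out_def)+

lemma crossing_rel_dual:
  assumes "quandle Q f" "a \<in> Q" "b \<in> Q" "c \<in> Q"
  shows "crossing_rel (right_div Q f) d a b c \<longleftrightarrow> crossing_rel f (\<not> d) a b c"
  using right_div_eq_iff[OF assms(1)] assms(2-4) unfolding crossing_rel_def by auto

lemma twist_coloring_dual:
  assumes "quandle Q f"
  shows "twist_coloring Q (right_div Q f) d n z \<longleftrightarrow> twist_coloring Q f (\<not> d) n z"
proof (cases "\<forall>i\<le>Suc n. z i \<in> Q")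
  case True
  then have rel: "crossing_rel (right_div Q f) e (z i) (z j) (z k) \<longleftrightarrow> crossing_rel f (\<not> e) (z i) (z j) (z k)"
    if "i \<le> Suc n" "j \<le> Suc n" "k \<le> Suc n" for e i j k
    using that by (intro crossing_rel_dual[OF assms]) auto
  have neg: "(\<not> (d \<longleftrightarrow> p)) \<longleftrightarrow> ((\<not> d) \<longleftrightarrow> p)" for p
    by blast
  show ?thesis
    unfolding twist_coloring_def neg[symmetric] by (simp add: rel cong: conj_cong)
qed (auto simp: twist_coloring_def)

text \<open>The strand from \<open>B i\<close> to \<open>T (i + 1)\<close> has one color, so the colors of all edges can be
  arranged in one sequence: \<open>T i\<close> has color \<open>z\<^sub>i\<close>, \<open>B i\<close> has color \<open>z\<^sub>i\<^sub>+\<^sub>1\<close>, and the two edges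
  of the bigon continue the sequence at its two ends.\<close>

lemma colorable_iff_twist_coloring_directed:
  fixes f :: "'a \<Rightarrow> 'a \<Rightarrow> 'a" and T B :: "nat \<Rightarrow> 'e" and CL CR :: 'e
  assumes L: "set L = (\<lambda>i. L ! i) ` {..<n} \<union> {xl, xu}"
    and edges: "edges L = T ` {..n} \<union> B ` {..n} \<union> {CL, CR}"
    and row: "\<And>i \<phi>. i < n \<Longrightarrow> colored f \<phi> (L ! i) \<longleftrightarrow> \<phi> (T (Suc i)) = \<phi> (B i) \<and>
      crossing_rel f (d \<longleftrightarrow> even i) (\<phi> (T i)) (\<phi> (B i)) (\<phi> (B (Suc i)))"
    and low: "\<And>\<phi>. colored f \<phi> xl \<longleftrightarrow> \<phi> (T 0) = \<phi> CR \<and>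
      crossing_rel f d (\<phi> CL) (\<phi> (T 0)) (\<phi> (T n))"
    and up: "\<And>\<phi>. colored f \<phi> xu \<longleftrightarrow> \<phi> (B n) = \<phi> CL \<and>
      crossing_rel f (d \<longleftrightarrow> odd n) (\<phi> (B 0)) (\<phi> CL) (\<phi> CR)"
    and labels: "\<And>z. \<exists>\<phi>. (\<forall>i. \<phi> (T i) = z i \<and> \<phi> (B i) = z (Suc i)) \<and>
      \<phi> CR = z 0 \<and> \<phi> CL = (z (Suc n) :: 'a)"
  shows "colorable Q f L \<longleftrightarrow>
    (\<exists>z. twist_coloring Q f d n z \<and> (\<exists>i\<le>Suc n. z i \<noteq> z 0))"
proof -
  have ec: "edge_coloring Q f L \<phi> \<longleftrightarrow> (\<forall>e\<in>edges L. \<phi> e \<in> Q) \<and>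
    (\<forall>i<n. colored f \<phi> (L ! i)) \<and> colored f \<phi> xl \<and> colored f \<phi> xu" for \<phi>
    unfolding edge_coloring_def L colored_def by auto
  show ?thesis
  proof
    assume "colorable Q f L"
    then obtain \<phi> e e' where \<phi>: "edge_coloring Q f L \<phi>"
      and e: "e \<in> edges L" "e' \<in> edges L" "\<phi> e \<noteq> \<phi> e'"
      unfolding colorable_iff_edge_coloring by blast
    define z where "z i = (case i of 0 \<Rightarrow> \<phi> (T 0) | Suc j \<Rightarrow> \<phi> (B j))" for i
    have zT: "\<phi> (T i) = z i" if "i \<le> n" for i
      using that \<phi> row unfolding ec z_def by (cases i) auto
    have zB: "\<phi> (B i) = z (Suc i)" for i
      by (simp add: z_def)
    have zC: "\<phi> CR = z 0" "\<phi> CL = z (Suc n)"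
      using \<phi> unfolding ec low up by (simp_all add: z_def)
    have Q': "\<phi> e \<in> Q" if "e \<in> edges L" for e
      using \<phi> that unfolding ec by blast
    have "z i \<in> Q" if "i \<le> Suc n" for i
      using Q'[of "T 0"] Q'[of "B (i - 1)"] that zT[of 0] zB[of "i - 1"] unfolding edges
      by (cases i) auto
    then have "twist_coloring Q f d n z"
      using \<phi> row unfolding twist_coloring_def ec low up by (simp add: zT zB zC)
    moreover have "\<exists>i\<le>Suc n. z i \<noteq> z 0"
    proof (rule ccontr)
      assume "\<not> ?thesis"
      then have z0: "z i = z 0" if "i \<le> Suc n" for i
        using that by blast
      have "\<phi> e = z 0" if "e \<in> edges L" for e
        using that unfolding edges by (auto simp: zT zB zC intro!: z0)
      with e show False by metis
    qed
    ultimately show "\<exists>z. twist_coloring Q f d n z \<and>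
        (\<exists>i\<le>Suc n. z i \<noteq> z 0)"
      by blast
  next
    assume "\<exists>z. twist_coloring Q f d n z \<and> (\<exists>i\<le>Suc n. z i \<noteq> z 0)"
    then obtain z i where z: "twist_coloring Q f d n z"
      and i: "i \<le> Suc n" "z i \<noteq> z 0"
      by blast
    obtain \<phi> where \<phi>: "\<And>i. \<phi> (T i) = z i" "\<And>i. \<phi> (B i) = z (Suc i)"
      "\<phi> CR = z 0" "\<phi> CL = z (Suc n)"
      using labels[of z] by blast
    have "edge_coloring Q f L \<phi>"
      using z row unfolding twist_coloring_def ec low up edges by (auto simp: \<phi>)
    moreover have "T 0 \<in> edges L" "B (i - 1) \<in> edges L" "\<phi> (T 0) \<noteq> \<phi> (B (i - 1))"
      using i unfolding edges by (cases i; auto simp: \<phi>)+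
    ultimately show "colorable Q f L"
      unfolding colorable_iff_edge_coloring by blast
  qed
qed

lemma set_split_clasp:
  assumes "length L = n + 2" "{l, u} = {n, Suc n}"
  shows "set L = (\<lambda>i. L ! i) ` {..<n} \<union> {L ! l, L ! u}"
proof -
  have "set L = (\<lambda>i. L ! i) ` {..<n + 2}"
    using assms(1) by (auto simp: set_conv_nth)
  also have "{..<n + 2} = {..<n} \<union> {l, u}"
    unfolding assms(2) by auto
  finally show ?thesis by auto
qed

lemma edges_twist:
  assumes L: "set L = (\<lambda>i. L ! i) ` {..<n} \<union> {L ! l, L ! u}"
    and row: "\<And>i. i < n \<Longrightarrow> passes (L ! i) (B i) (T (Suc i)) (T i) (B (Suc i))"
    and low: "passes (L ! l) (T 0) CR (T n) CL"
    and up: "passes (L ! u) CL (B n) CR (B 0)"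
  shows "edges L = T ` {..n} \<union> B ` {..n} \<union> {CL, CR}"
proof -
  have ends: "{over_in x, over_out x, under_right x, under_left x} = {a, b, c, d}"
    if "passes x a b c d" for x :: "'a ocrossing" and a b c d
    using that unfolding passes_def under_in_def under_out_def by (cases "positive x") auto
  have e: "e \<in> edges L \<longleftrightarrow> (\<exists>i<n. e \<in> {B i, T (Suc i), T i, B (Suc i)}) \<or>
    e \<in> {T 0, CR, T n, CL} \<or> e \<in> {CL, B n, CR, B 0}" for e
    unfolding edges_def L UN_Un image_image UN_simps UN_insert ends[OF low] ends[OF up]
    using ends[OF row] by blast
  define R where "R = T ` {..n} \<union> B ` {..n} \<union> {CL, CR}"
  have R: "T i \<in> R" "B i \<in> R" "CL \<in> R" "CR \<in> R" if "i \<le> n" for i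
    using that unfolding R_def by auto
  have "edges L \<subseteq> R"
    using e R R[of 0] by auto
  moreover have "R \<subseteq> edges L"
    unfolding R_def by (auto simp: e le_less)
  ultimately show ?thesis
    unfolding R_def by (rule equalityI)
qed

text \<open>The flag \<open>s\<close> distinguishes the diagram from its mirror image. Right and left of an
  over-strand depend on its direction and on the chirality, so only the combination of \<open>s\<close> with
  the direction \<open>r\<close> survives.\<close>

lemma colorable_iff_twist_coloring_oriented:
  fixes T B :: "nat \<Rightarrow> 'e" and CL CR :: 'e
  assumes D: "oriented_diagram L" and len: "length L = n + 2" and n: "n > 0"
    and lu: "{l, u} = {n, Suc n}"
    and row: "\<And>i. i < n \<Longrightarrow> passes (L ! i) (B i) (T (Suc i)) (T i) (B (Suc i))"
    and low: "passes (L ! l) (T 0) CR (T n) CL"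
    and up: "passes (L ! u) CL (B n) CR (B 0)"
    and row': "\<And>(f :: 'a \<Rightarrow> 'a \<Rightarrow> 'a) \<phi> i. i < n \<Longrightarrow> colored f \<phi> (L ! i) \<longleftrightarrow> \<phi> (T (Suc i)) = \<phi> (B i) \<and>
      crossing_rel f ((over_in (L ! i) = B i) = s) (\<phi> (T i)) (\<phi> (B i)) (\<phi> (B (Suc i)))"
    and low': "\<And>(f :: 'a \<Rightarrow> 'a \<Rightarrow> 'a) \<phi>. colored f \<phi> (L ! l) \<longleftrightarrow> \<phi> (T 0) = \<phi> CR \<and>
      crossing_rel f ((over_in (L ! l) = T 0) = s) (\<phi> CL) (\<phi> (T 0)) (\<phi> (T n))"
    and up': "\<And>(f :: 'a \<Rightarrow> 'a \<Rightarrow> 'a) \<phi>. colored f \<phi> (L ! u) \<longleftrightarrow> \<phi> (B n) = \<phi> CL \<and>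
      crossing_rel f ((over_in (L ! u) = CL) = s) (\<phi> (B 0)) (\<phi> CL) (\<phi> CR)"
    and labels: "\<And>z. \<exists>\<phi>. (\<forall>i. \<phi> (T i) = z i \<and> \<phi> (B i) = z (Suc i)) \<and>
      \<phi> CR = z 0 \<and> \<phi> CL = (z (Suc n) :: 'a)"
  shows "\<exists>d. \<forall>Q (f :: 'a \<Rightarrow> 'a \<Rightarrow> 'a). colorable Q f L \<longleftrightarrow>
    (\<exists>z. twist_coloring Q f d n z \<and> (\<exists>i\<le>Suc n. z i \<noteq> z 0))"
proof -
  obtain r where r: "\<And>i. i < n \<Longrightarrow> over_in (L ! i) = B i \<longleftrightarrow> (r \<longleftrightarrow> even i)"
    "over_in (L ! l) = T 0 \<longleftrightarrow> r" "over_in (L ! u) = CL \<longleftrightarrow> (r \<longleftrightarrow> odd n)"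
    using twist_orientation[OF D len n lu row low up] by blast
  have assoc: "((r \<longleftrightarrow> p) = s) \<longleftrightarrow> ((r \<longleftrightarrow> s) \<longleftrightarrow> p)" for p
    by blast
  have L: "set L = (\<lambda>i. L ! i) ` {..<n} \<union> {L ! l, L ! u}"
    using set_split_clasp[OF len lu] .
  show ?thesis
  proof (intro exI[of _ "r \<longleftrightarrow> s"] allI)
    fix Q and f :: "'a \<Rightarrow> 'a \<Rightarrow> 'a"
    show "colorable Q f L \<longleftrightarrow>
      (\<exists>z. twist_coloring Q f (r \<longleftrightarrow> s) n z \<and> (\<exists>i\<le>Suc n. z i \<noteq> z 0))"
    proof (rule colorable_iff_twist_coloring_directed[where T = T and B = B and CL = CL and CR = CR
          and xl = "L ! l" and xu = "L ! u"])
      show "edges L = T ` {..n} \<union> B ` {..n} \<union> {CL, CR}"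
        using edges_twist[OF L row low up] .
    qed (simp_all only: L labels row' low' up' r assoc)
  qed
qed

text \<open>For the mirror image the upper and lower edges change places, and so do the two crossings
  of the clasp.\<close>

lemma colorable_iff_twist_coloring:
  assumes "twist_knot c L" "c \<ge> 3"
  shows "\<exists>d. \<forall>Q (f :: 'a \<Rightarrow> 'a \<Rightarrow> 'a). colorable Q f L \<longleftrightarrow>
    (\<exists>z. twist_coloring Q f d (c - 2) z \<and> (\<exists>i\<le>Suc (c - 2). z i \<noteq> z 0))"
proof -
  define n where "n = c - 2"
  have n: "n > 0" using assms(2) by (simp add: n_def)
  have at: "twist_row n ! i = Crossing (Bot i) (Bot (Suc i)) (Top (Suc i)) (Top i)" if "i < n" for i
    using that by (simp add: twist_row_def)
  have len: "length (twist_row n) = n" "length (twist_clasp n) = 2"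
    by (simp_all add: twist_row_def twist_clasp_def)
  have diag: "twist_diagram c = twist_row n @ twist_clasp n"
    by (simp add: twist_diagram_def n_def)
  have nth: "i < n \<Longrightarrow> twist_diagram c ! i = Crossing (Bot i) (Bot (Suc i)) (Top (Suc i)) (Top i)"
    "twist_diagram c ! n = Crossing ClaspL ClaspR (Bot n) (Bot 0)"
    "twist_diagram c ! (Suc n) = Crossing (Top 0) (Top n) ClaspR ClaspL" for i
    unfolding diag by (simp_all add: nth_append len at twist_clasp_def)
  have len': "length (twist_diagram c) = n + 2"
    by (simp add: diag len)
  have symm: "crossing_rel f (\<not> p) a b e \<longleftrightarrow> crossing_rel f p e b a" for f :: "'a \<Rightarrow> 'a \<Rightarrow> 'a" and p a b e
    by (simp add: crossing_rel_def)
  consider (plain) "orientation_of (twist_diagram c) L"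
    | (mirror) "orientation_of (map mirror_crossing (twist_diagram c)) L"
    using assms(1) unfolding twist_knot_def by blast
  then show ?thesis
  proof cases
    case plain
    then have D: "oriented_diagram L" and L: "length L = n + 2"
      and or: "\<And>i. i < n + 2 \<Longrightarrow> orients_crossing (twist_diagram c ! i) (L ! i)"
      unfolding orientation_of_def by (auto simp: list_all2_conv_all_nth len')
    have row: "orients_crossing (Crossing (Bot i) (Bot (Suc i)) (Top (Suc i)) (Top i)) (L ! i)"
      if "i < n" for i
      using or[of i] that by (simp add: nth)
    have up: "orients_crossing (Crossing ClaspL ClaspR (Bot n) (Bot 0)) (L ! n)"
      using or[of n] by (simp add: nth)
    have low: "orients_crossing (Crossing (Top 0) (Top n) ClaspR ClaspL) (L ! (Suc n))"
      using or[of "Suc n"] by (simp add: nth del: add_Suc_right One_nat_def)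
    show ?thesis
      unfolding n_def[symmetric]
    proof (rule colorable_iff_twist_coloring_oriented[where L = L and n = n and l = "Suc n" and u = n
          and T = Top and B = Bot and CL = ClaspL and CR = ClaspR and s = False and 'a = 'a])
      show "passes (L ! i) (Bot i) (Top (Suc i)) (Top i) (Bot (Suc i))"
        and "colored f \<phi> (L ! i) \<longleftrightarrow> \<phi> (Top (Suc i)) = \<phi> (Bot i) \<and>
          crossing_rel f ((over_in (L ! i) = Bot i) = False) (\<phi> (Top i)) (\<phi> (Bot i)) (\<phi> (Bot (Suc i)))"
        if "i < n" for i and f :: "'a \<Rightarrow> 'a \<Rightarrow> 'a" and \<phi>
        by (auto simp: orients_crossingD(2,5)[OF row[OF that]] symm)
      show "passes (L ! (Suc n)) (Top 0) ClaspR (Top n) ClaspL"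
        and "colored f \<phi> (L ! (Suc n)) \<longleftrightarrow> \<phi> (Top 0) = \<phi> ClaspR \<and>
          crossing_rel f ((over_in (L ! (Suc n)) = Top 0) = False) (\<phi> ClaspL) (\<phi> (Top 0)) (\<phi> (Top n))"
        for f :: "'a \<Rightarrow> 'a \<Rightarrow> 'a" and \<phi>
        using n by (auto simp: orients_crossingD(1,5)[OF low] symm)
      show "passes (L ! n) ClaspL (Bot n) ClaspR (Bot 0)"
        and "colored f \<phi> (L ! n) \<longleftrightarrow> \<phi> (Bot n) = \<phi> ClaspL \<and>
          crossing_rel f ((over_in (L ! n) = ClaspL) = False) (\<phi> (Bot 0)) (\<phi> ClaspL) (\<phi> ClaspR)"
        for f :: "'a \<Rightarrow> 'a \<Rightarrow> 'a" and \<phi>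
        using n by (auto simp: orients_crossingD(1,5)[OF up] symm)
      show "\<exists>\<phi>. (\<forall>i. \<phi> (Top i) = z i \<and> \<phi> (Bot i) = z (Suc i)) \<and>
        \<phi> ClaspR = z 0 \<and> \<phi> ClaspL = z (Suc n)" for z :: "nat \<Rightarrow> 'a"
        by (rule exI[of _ "\<lambda>e. case e of Top i \<Rightarrow> z i | Bot i \<Rightarrow> z (Suc i) | ClaspR \<Rightarrow> z 0
          | ClaspL \<Rightarrow> z (Suc n)"]) simp
    qed (use D L n in auto)
  next
    case mirror
    then have D: "oriented_diagram L" and L: "length L = n + 2"
      and or: "\<And>i. i < n + 2 \<Longrightarrow> orients_crossing (mirror_crossing (twist_diagram c ! i)) (L ! i)"
      unfolding orientation_of_def by (auto simp: list_all2_conv_all_nth len')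
    have row: "orients_crossing (Crossing (Bot (Suc i)) (Top (Suc i)) (Top i) (Bot i)) (L ! i)"
      if "i < n" for i
      using or[of i] that by (simp add: nth)
    have low: "orients_crossing (Crossing ClaspR (Bot n) (Bot 0) ClaspL) (L ! n)"
      using or[of n] by (simp add: nth)
    have up: "orients_crossing (Crossing (Top n) ClaspR ClaspL (Top 0)) (L ! (Suc n))"
      using or[of "Suc n"] by (simp add: nth del: add_Suc_right One_nat_def)
    show ?thesis
      unfolding n_def[symmetric]
    proof (rule colorable_iff_twist_coloring_oriented[where L = L and n = n and l = n and u = "Suc n"
          and T = Bot and B = Top and CL = ClaspL and CR = ClaspR and s = True and 'a = 'a])
      show "passes (L ! i) (Top i) (Bot (Suc i)) (Bot i) (Top (Suc i))"
        and "colored f \<phi> (L ! i) \<longleftrightarrow> \<phi> (Bot (Suc i)) = \<phi> (Top i) \<and>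
          crossing_rel f ((over_in (L ! i) = Top i) = True) (\<phi> (Bot i)) (\<phi> (Top i)) (\<phi> (Top (Suc i)))"
        if "i < n" for i and f :: "'a \<Rightarrow> 'a \<Rightarrow> 'a" and \<phi>
        by (auto simp: orients_crossingD(4,5,6)[OF row[OF that]] symm)
      show "passes (L ! n) (Bot 0) ClaspR (Bot n) ClaspL"
        and "colored f \<phi> (L ! n) \<longleftrightarrow> \<phi> (Bot 0) = \<phi> ClaspR \<and>
          crossing_rel f ((over_in (L ! n) = Bot 0) = True) (\<phi> ClaspL) (\<phi> (Bot 0)) (\<phi> (Bot n))"
        for f :: "'a \<Rightarrow> 'a \<Rightarrow> 'a" and \<phi>
        using n by (auto simp: orients_crossingD(3,5,6)[OF low] symm)
      show "passes (L ! (Suc n)) ClaspL (Top n) ClaspR (Top 0)"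
        and "colored f \<phi> (L ! (Suc n)) \<longleftrightarrow> \<phi> (Top n) = \<phi> ClaspL \<and>
          crossing_rel f ((over_in (L ! (Suc n)) = ClaspL) = True) (\<phi> (Top 0)) (\<phi> ClaspL) (\<phi> ClaspR)"
        for f :: "'a \<Rightarrow> 'a \<Rightarrow> 'a" and \<phi>
        using n by (auto simp: orients_crossingD(3,5,6)[OF up] symm)
      show "\<exists>\<phi>. (\<forall>i. \<phi> (Bot i) = z i \<and> \<phi> (Top i) = z (Suc i)) \<and>
        \<phi> ClaspR = z 0 \<and> \<phi> ClaspL = z (Suc n)" for z :: "nat \<Rightarrow> 'a"
        by (rule exI[of _ "\<lambda>e. case e of Bot i \<Rightarrow> z i | Top i \<Rightarrow> z (Suc i) | ClaspR \<Rightarrow> z 0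
          | ClaspL \<Rightarrow> z (Suc n)"]) simp
    qed (use D L n in auto)
  qed
qed

section \<open>Affine colorings\<close>

lemma modular_inverse_dvd:
  fixes k p :: int
  assumes "coprime k p"
  shows "p dvd k * modular_inverse p k - 1"
proof -
  have "[k * modular_inverse p k = 1] (mod p)"
    using assms by (simp add: cong_modular_inverse1 cong_modular_inverse2)
  then show ?thesis
    by (simp add: cong_iff_dvd_diff)
qed

text \<open>Multiplying by the invertible \<open>k\<close> turns the operation into a congruence that is symmetric
  under exchanging \<open>a\<close> with \<open>c\<close> and \<open>l\<close> with \<open>k\<close>; thus the dual quandle arises by exchanging \<open>l\<close>
  and \<open>k\<close>.\<close>

lemma Zn_op_eq_iff:
  assumes "coprime k p" "c \<in> Zn_carrier p"
  shows "Zn_op p l k a b = c \<longleftrightarrow> p dvd l * a + k * c - (l + k) * b"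
proof -
  let ?i = "modular_inverse p k" and ?x = "(l + k) * b - l * a"
  have "Zn_op p l k a b = c \<longleftrightarrow> (?x * ?i) mod p = c mod p"
    using assms(2) by (simp add: Zn_op_def Zn_carrier_def)
  also have "\<dots> \<longleftrightarrow> p dvd ?x * ?i - c"
    by (rule mod_eq_dvd_iff)
  also have "\<dots> \<longleftrightarrow> p dvd k * (?x * ?i - c)"
    using assms(1) by (simp add: coprime_dvd_mult_right_iff coprime_commute)
  also have "k * (?x * ?i - c) = ?x * (k * ?i - 1) - (l * a + k * c - (l + k) * b)"
    by (simp add: algebra_simps)
  also have "p dvd \<dots> \<longleftrightarrow> p dvd l * a + k * c - (l + k) * b"
    using modular_inverse_dvd[OF assms(1)] by (simp add: dvd_diff_right_iff)
  finally show ?thesis .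
qed

lemma Zn_op_closed: "p > 0 \<Longrightarrow> Zn_op p l k a b \<in> Zn_carrier p"
  by (simp add: Zn_op_def Zn_carrier_def)

lemma quandle_Zn:
  assumes "p > 0" "coprime k p" "coprime l p"
  shows "quandle (Zn_carrier p) (Zn_op p l k)"
proof (rule quandleI)
  let ?f = "Zn_op p l k"
  note closed = Zn_op_closed[OF assms(1)]
  show "Zn_carrier p \<noteq> {}"
    using assms(1) by (auto simp: Zn_carrier_def)
  show "?f a b \<in> Zn_carrier p" for a b
    by (rule closed)
  show "?f a a = a" if "a \<in> Zn_carrier p" for a
    using that assms by (simp add: Zn_op_eq_iff distrib_right)
  have swap: "?f c b = a \<longleftrightarrow> Zn_op p k l a b = c" if "a \<in> Zn_carrier p" "c \<in> Zn_carrier p" for a b c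
    using that assms by (simp add: Zn_op_eq_iff add.commute)
  show "\<exists>!c. c \<in> Zn_carrier p \<and> ?f c b = a" if "a \<in> Zn_carrier p" for a b
    using closed swap[OF that] by metis
  show "?f (?f a b) c = ?f (?f a c) (?f b c)" for a b c
  proof -
    have eq: "p dvd l * x + k * ?f x y - (l + k) * y" for x y
      by (rule iffD1[OF Zn_op_eq_iff[OF assms(2) closed] refl])
    let ?w = "?f (?f a c) (?f b c)"
    have "p dvd (l + k) * (l * b + k * ?f b c - (l + k) * c)
      - l * (l * a + k * ?f a c - (l + k) * c)
      + k * (l * ?f a c + k * ?w - (l + k) * ?f b c)
      + l * (l * a + k * ?f a b - (l + k) * b)"
      by (intro dvd_add dvd_diff dvd_mult eq)
    also have "\<dots> = k * (l * ?f a b + k * ?w - (l + k) * c)"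
      by (simp add: algebra_simps)
    finally have "p dvd l * ?f a b + k * ?w - (l + k) * c"
      using assms(2) by (simp add: coprime_dvd_mult_right_iff coprime_commute)
    then show ?thesis
      by (simp add: Zn_op_eq_iff[OF assms(2) closed])
  qed
qed

lemma finite_Zn: "finite (Zn_carrier p)" and card_Zn: "card (Zn_carrier p) = nat p"
  by (simp_all add: Zn_carrier_def)

text \<open>Up to sign and powers of \<open>t\<close>, the Alexander polynomial of the twist knot with \<open>n\<close>
  half-twists is \<open>j (1 - t)\<^sup>2 - t\<close> for \<open>n = 2 j\<close> and \<open>(j + 1) (1 - t)\<^sup>2 + t\<close> for \<open>n = 2 j + 1\<close>;
  this is its value at \<open>t = - l / k\<close>, multiplied by \<open>k\<^sup>2\<close>.\<close>

definition alexander_twist :: "nat \<Rightarrow> int \<Rightarrow> int \<Rightarrow> int" where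
  "alexander_twist n l k = (if even n then (l + k)\<^sup>2 * int (n div 2) + l * k
     else (l + k)\<^sup>2 * int (n div 2 + 1) - l * k)"

lemma crossing_rel_Zn:
  assumes "p > 0" "coprime k p" "coprime l p"
  shows "crossing_rel (Zn_op p l k) d (a mod p) (b mod p) (c mod p) \<longleftrightarrow>
    p dvd (if d then l * a + k * c else k * a + l * c) - (l + k) * b"
proof -
  have "p dvd l * (a mod p) + k * (c mod p) - (l + k) * (b mod p) \<longleftrightarrow>
      p dvd l * a + k * c - (l + k) * b" for a c l k
  proof -
    have "[l * (a mod p) + k * (c mod p) - (l + k) * (b mod p) = l * a + k * c - (l + k) * b] (mod p)"
      by (intro cong_add cong_diff cong_mult cong_refl) (simp_all add: cong_def)
    then show ?thesis
      unfolding dvd_eq_mod_eq_0 cong_def by simp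
  qed
  moreover have "x mod p \<in> Zn_carrier p" for x
    using assms(1) by (simp add: Zn_carrier_def)
  ultimately show ?thesis
    using assms(2) by (simp add: crossing_rel_def Zn_op_eq_iff add.commute)
qed

text \<open>In an affine quandle the translation along the row adds a constant. Scaled so that all
  colors are integral, the coloring is \<open>z\<^sub>2\<^sub>j = (l + k) j\<close> and \<open>z\<^sub>2\<^sub>j\<^sub>+\<^sub>1 = (l + k) j + k\<close>. The
  relations of the row hold for all integers, and both relations of the clasp say that the
  Alexander polynomial vanishes. For the dual quandle \<open>k\<close> and \<open>l\<close> are exchanged, which leaves
  this condition unchanged.\<close>

lemma affine_twist_coloring:
  assumes "p > 1" "coprime k p" "coprime l p" "p dvd alexander_twist n l k"
  shows "\<exists>z. twist_coloring (Zn_carrier p) (Zn_op p l k) d n z \<and> (\<exists>i\<le>Suc n. z i \<noteq> z 0)"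
proof -
  define m where "m = (if d then k else l)"
  define Z where "Z i = (l + k) * int (i div 2) + (if even i then 0 else m)" for i
  have Z_even: "Z (2 * j) = (l + k) * int j" and Z_odd: "Z (Suc (2 * j)) = (l + k) * int j + m" for j
    by (simp_all add: Z_def)
  have p: "p > 0" using assms(1) by simp
  note rel = crossing_rel_Zn[OF p assms(2,3)]
  have "crossing_rel (Zn_op p l k) (d \<longleftrightarrow> even i) (Z i mod p) (Z (Suc i) mod p) (Z (Suc (Suc i)) mod p)" for i
  proof (cases "even i")
    case True
    then obtain j where "i = 2 * j" by blast
    then show ?thesis
      unfolding rel using Z_even[of j] Z_even[of "Suc j"] Z_odd[of j]
      by (auto simp: m_def algebra_simps)
  next
    case False
    then obtain j where "i = Suc (2 * j)" by (metis oddE Suc_eq_plus1)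
    then show ?thesis
      unfolding rel using Z_even[of "Suc j"] Z_odd[of "Suc j"] Z_odd[of j]
      by (auto simp: m_def algebra_simps)
  qed
  moreover have "crossing_rel (Zn_op p l k) d (Z (Suc n) mod p) (Z 0 mod p) (Z n mod p) \<and>
     crossing_rel (Zn_op p l k) (d \<longleftrightarrow> odd n) (Z 1 mod p) (Z (Suc n) mod p) (Z 0 mod p)"
  proof (cases "even n")
    case True
    then obtain j where j: "n = 2 * j" by blast
    then have alex: "p dvd (l + k)\<^sup>2 * int j + l * k"
      using assms(4) by (simp add: alexander_twist_def)
    have Z: "Z 0 = 0" "Z 1 = m" "Z n = (l + k) * int j" "Z (Suc n) = (l + k) * int j + m"
      using Z_odd[of 0] by (simp_all add: Z_def j)
    have "(if d then l * Z (Suc n) + k * Z n else k * Z (Suc n) + l * Z n) - (l + k) * Z 0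
        = (l + k)\<^sup>2 * int j + l * k"
      "(if d \<longleftrightarrow> odd n then l * Z 1 + k * Z 0 else k * Z 1 + l * Z 0) - (l + k) * Z (Suc n)
        = - ((l + k)\<^sup>2 * int j + l * k)"
      using True unfolding Z by (auto simp: m_def algebra_simps power2_eq_square)
    with alex show ?thesis
      unfolding rel by (simp only: dvd_minus_iff)
  next
    case False
    then obtain j where j: "n = Suc (2 * j)" by (metis oddE Suc_eq_plus1)
    then have alex: "p dvd (l + k)\<^sup>2 * int (Suc j) - l * k"
      using assms(4) by (simp add: alexander_twist_def)
    have Z: "Z 0 = 0" "Z 1 = m" "Z n = (l + k) * int j + m" "Z (Suc n) = (l + k) * int (Suc j)"
      using Z_odd[of 0] Z_even[of "Suc j"] by (simp_all add: Z_def j)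
    have "(if d then l * Z (Suc n) + k * Z n else k * Z (Suc n) + l * Z n) - (l + k) * Z 0
        = (l + k)\<^sup>2 * int (Suc j) - l * k"
      "(if d \<longleftrightarrow> odd n then l * Z 1 + k * Z 0 else k * Z 1 + l * Z 0) - (l + k) * Z (Suc n)
        = - ((l + k)\<^sup>2 * int (Suc j) - l * k)"
      using False unfolding Z by (auto simp: m_def algebra_simps power2_eq_square)
    with alex show ?thesis
      unfolding rel by (simp only: dvd_minus_iff)
  qed
  ultimately have "twist_coloring (Zn_carrier p) (Zn_op p l k) d n (\<lambda>i. Z i mod p)"
    using p unfolding twist_coloring_def by (auto simp: Zn_carrier_def)
  moreover have "\<not> p dvd m"
    using assms(1-3) unfolding m_def by (auto dest: coprime_common_divisor)
  then have "Z 1 mod p \<noteq> Z 0 mod p"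
    using Z_odd[of 0] Z_even[of 0] by (simp add: dvd_eq_mod_eq_0)
  ultimately show ?thesis
    by (intro exI[of _ "\<lambda>i. Z i mod p"] conjI exI[of _ 1]) auto
qed

section \<open>Colorings by the tetrahedron quandle\<close>

lemma S4_carrier_iff: "p \<in> S4_carrier \<longleftrightarrow> (\<exists>a b. p = [:a, b:])"
proof
  assume "p \<in> S4_carrier"
  then have "p = [:poly.coeff p 0, poly.coeff p 1:]"
    by (intro poly_eqI) (auto simp: S4_carrier_def coeff_pCons coeff_eq_0 split: nat.split)
  then show "\<exists>a b. p = [:a, b:]" by blast
qed (auto simp: S4_carrier_def)

lemma S4_carrier_eq: "S4_carrier = (\<lambda>(a, b). [:a, b:]) ` (UNIV :: (bit \<times> bit) set)"
  by (auto simp: S4_carrier_iff image_iff)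

lemma finite_S4: "finite S4_carrier" and card_S4: "card S4_carrier = 4"
proof -
  have "inj (\<lambda>(a :: bit, b). [:a, b:])"
    by (auto simp: inj_def)
  moreover have bits: "(UNIV :: bit set) = {0, 1}"
    by (auto simp: set_eq_iff)
  then have "card (UNIV :: (bit \<times> bit) set) = 4"
    unfolding UNIV_Times_UNIV[symmetric] by (simp only: bits card_cartesian_product) simp
  moreover have "finite (UNIV :: (bit \<times> bit) set)"
    unfolding UNIV_Times_UNIV[symmetric] bits by simp
  ultimately show "finite S4_carrier" "card S4_carrier = 4"
    unfolding S4_carrier_eq by (simp_all add: card_image)
qed

text \<open>Multiplication by \<open>t\<close> modulo \<open>t\<^sup>2 + t + 1\<close>, in coordinates; all further computations in
  this quandle are linear over the field with two elements.\<close>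

lemma S4_op_linear: "S4_op [:a, b:] [:c, d:] = [:b + c + d, a + b + c:]"
proof -
  have "[:0, 1:] * [:a, b:] + (1 - [:0, 1:]) * [:c, d:] = [:c, a + c + d, b + d:]"
    by (cases a; cases b; cases c; cases d) (simp_all add: one_pCons)
  also have "\<dots> = [:b + d:] * [:1, 1, 1:] + [:b + c + d, a + b + c:]"
    by (cases a; cases b; cases c; cases d) simp_all
  finally have "S4_op [:a, b:] [:c, d:] =
      ([:b + d:] * [:1, 1, 1:] + [:b + c + d, a + b + c:]) mod [:1, 1, 1:]"
    unfolding S4_op_def by (rule arg_cong)
  also have "\<dots> = [:b + c + d, a + b + c:] mod [:1, 1, 1:]"
    by (rule mod_mult_self3)
  also have "\<dots> = [:b + c + d, a + b + c:]"
    by (rule mod_poly_less) simp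
  finally show ?thesis .
qed

lemma quandle_S4: "quandle S4_carrier S4_op"
proof (rule quandleI)
  have flip: "x + y = u \<longleftrightarrow> x = u + y" for x y u :: bit
    by (cases x; cases y; cases u) auto
  show "S4_carrier \<noteq> {}"
    using S4_carrier_iff by blast
  show "S4_op x y \<in> S4_carrier" if "x \<in> S4_carrier" "y \<in> S4_carrier" for x y
    using that by (auto simp: S4_carrier_iff S4_op_linear)
  show "S4_op x x = x" if "x \<in> S4_carrier" for x
    using that by (auto simp: S4_carrier_iff S4_op_linear flip add_ac)
  show "\<exists>!c. c \<in> S4_carrier \<and> S4_op c y = x" if "x \<in> S4_carrier" "y \<in> S4_carrier" for x y
  proof -
    obtain a b where x: "x = [:a, b:]"
      using \<open>x \<in> S4_carrier\<close> S4_carrier_iff by blast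
    obtain c d where y: "y = [:c, d:]"
      using \<open>y \<in> S4_carrier\<close> S4_carrier_iff by blast
    have inverse: "S4_op [:u, v:] y = x \<longleftrightarrow> u = a + b + d \<and> v = a + c + d" for u v
      unfolding x y S4_op_linear
      by (cases a; cases b; cases c; cases d; cases u; cases v) simp_all
    show ?thesis
    proof (rule ex1I[of _ "[:a + b + d, a + c + d:]"])
      show "[:a + b + d, a + c + d:] \<in> S4_carrier \<and> S4_op [:a + b + d, a + c + d:] y = x"
        using inverse S4_carrier_iff by blast
      show "p = [:a + b + d, a + c + d:]" if "p \<in> S4_carrier \<and> S4_op p y = x" for p
      proof -
        obtain u v where p: "p = [:u, v:]"
          using \<open>p \<in> S4_carrier \<and> S4_op p y = x\<close> S4_carrier_iff by blast
        then have "S4_op [:u, v:] y = x"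
          using \<open>p \<in> S4_carrier \<and> S4_op p y = x\<close> by blast
        then show ?thesis
          unfolding inverse p by blast
      qed
    qed
  qed
  show "S4_op (S4_op x y) w = S4_op (S4_op x w) (S4_op y w)"
    if mem: "x \<in> S4_carrier" "y \<in> S4_carrier" "w \<in> S4_carrier" for x y w
  proof -
    obtain a b c d u v where "x = [:a, b:]" "y = [:c, d:]" "w = [:u, v:]"
      using mem S4_carrier_iff by metis
    then show ?thesis
      by (cases a; cases b; cases c; cases d; cases u; cases v) (simp_all only: S4_op_linear, simp_all)
  qed
qed

text \<open>Over the field with four elements the translation has order two, so the coloring has
  period four: it runs through all four elements, and the orientation decides in which order the
  last two appear.\<close>

lemma tetrahedron_twist_coloring:
  assumes "n mod 4 \<in> {1, 2}"
  shows "\<exists>z. twist_coloring S4_carrier S4_op d n z \<and> (\<exists>i\<le>Suc n. z i \<noteq> z 0)"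
proof -
  \<comment> \<open>The third color is \<open>0 * 1 = 1 + t\<close> in the quandle itself and \<open>t\<close> in its dual.\<close>
  define s :: bit where "s = (if d then 1 else 0)"
  define z where "z i = (if i mod 4 = 0 then [:0, 0:] else if i mod 4 = 1 then [:1, 0:]
    else if i mod 4 = 2 then [:s, 1:] else [:s + 1, 1:])" for i :: nat
  have z: "z i = [:0, 0:]" if "i mod 4 = 0" for i using that by (simp add: z_def)
  have z1: "z i = [:1, 0:]" if "i mod 4 = 1" for i using that by (simp add: z_def)
  have z2: "z i = [:s, 1:]" if "i mod 4 = 2" for i using that by (simp add: z_def)
  have z3: "z i = [:s + 1, 1:]" if "i mod 4 = 3" for i using that by (simp add: z_def)
  have cases: "i mod 4 = 0 \<or> i mod 4 = 1 \<or> i mod 4 = 2 \<or> i mod 4 = 3" for i :: nat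
    by auto
  have succ: "i mod 4 = 0 \<Longrightarrow> Suc i mod 4 = 1 \<and> even i" "i mod 4 = 1 \<Longrightarrow> Suc i mod 4 = 2 \<and> odd i"
    "i mod 4 = 2 \<Longrightarrow> Suc i mod 4 = 3 \<and> even i" "i mod 4 = 3 \<Longrightarrow> Suc i mod 4 = 0 \<and> odd i" for i :: nat
    by presburger+
  have "crossing_rel S4_op (d \<longleftrightarrow> even i) (z i) (z (Suc i)) (z (Suc (Suc i)))" for i
  proof -
    consider (0) "i mod 4 = 0" "Suc i mod 4 = 1" "Suc (Suc i) mod 4 = 2" "even i"
      | (1) "i mod 4 = 1" "Suc i mod 4 = 2" "Suc (Suc i) mod 4 = 3" "odd i"
      | (2) "i mod 4 = 2" "Suc i mod 4 = 3" "Suc (Suc i) mod 4 = 0" "even i"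
      | (3) "i mod 4 = 3" "Suc i mod 4 = 0" "Suc (Suc i) mod 4 = 1" "odd i"
      using cases[of i] succ[of i] succ[of "Suc i"] by metis
    then show ?thesis
      by cases (cases d; simp add: z z1 z2 z3 s_def crossing_rel_def S4_op_linear del: pCons_0_0)+
  qed
  moreover have "crossing_rel S4_op d (z (Suc n)) (z 0) (z n) \<and>
    crossing_rel S4_op (d \<longleftrightarrow> odd n) (z 1) (z (Suc n)) (z 0)"
  proof -
    consider (1) "n mod 4 = 1" "Suc n mod 4 = 2" "odd n" | (2) "n mod 4 = 2" "Suc n mod 4 = 3" "even n"
      using assms succ[of n] by (metis insertE singletonD)
    then show ?thesis
      by cases (cases d; simp add: z z1 z2 z3 s_def crossing_rel_def S4_op_linear del: pCons_0_0)+
  qed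
  moreover have "z i \<in> S4_carrier" for i
    unfolding S4_carrier_iff z_def by auto
  ultimately have "twist_coloring S4_carrier S4_op d n z"
    unfolding twist_coloring_def by blast
  moreover have "z 1 \<noteq> z 0"
    by (simp add: z_def)
  ultimately show ?thesis
    by (intro exI[of _ z] conjI exI[of _ 1]) auto
qed

section \<open>The translation along the row of half-twists\<close>

definition twist_step :: "'a set \<Rightarrow> ('a \<Rightarrow> 'a \<Rightarrow> 'a) \<Rightarrow> 'a \<Rightarrow> 'a \<Rightarrow> 'a \<Rightarrow> 'a" where
  "twist_step Q f a b x = f (right_div Q f x a) b"

lemma twist_step_closed:
  assumes "quandle Q f" "a \<in> Q" "b \<in> Q" "x \<in> Q"
  shows "twist_step Q f a b x \<in> Q"
  using assms by (simp add: twist_step_def quandle_closed right_div_closed)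

text \<open>The translation is a product of a right multiplication and the inverse of another one, and
  both are automorphisms.\<close>

lemma twist_step_hom:
  assumes "quandle Q f" "a \<in> Q" "b \<in> Q" "x \<in> Q" "y \<in> Q"
  shows "twist_step Q f a b (f x y) = f (twist_step Q f a b x) (twist_step Q f a b y)"
proof -
  let ?x = "right_div Q f x a" and ?y = "right_div Q f y a"
  have Q: "?x \<in> Q" "?y \<in> Q"
    using assms by (simp_all add: right_div_closed)
  have "f (f ?x ?y) a = f x y"
    using quandle_distrib[OF assms(1) Q assms(2)] assms by (simp add: right_div_mult)
  then have "right_div Q f (f x y) a = f ?x ?y"
    by (intro iffD2[OF right_div_eq_iff[OF assms(1)]]) (use assms Q quandle_closed in auto)
  then show ?thesis
    using quandle_distrib[OF assms(1) Q assms(3)] by (simp add: twist_step_def)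
qed

text \<open>The first two instances are computed; all the others follow by applying the automorphism
  to the crossing relation two places earlier.\<close>

lemma twist_coloring_step:
  assumes Q: "quandle Q f" and z: "twist_coloring Q f True n z" and "i < n"
  shows "z (Suc (Suc i)) = twist_step Q f (z 0) (z 1) (z i)"
  using \<open>i < n\<close>
proof (induction i rule: less_induct)
  case (less i)
  let ?s = "twist_step Q f (z 0) (z 1)"
  have mem: "z j \<in> Q" if "j \<le> Suc n" for j
    using z that by (simp add: twist_coloring_def)
  have even: "f (z j) (z (Suc j)) = z (Suc (Suc j))" if "even j" "j < n" for j
    using z that unfolding twist_coloring_def crossing_rel_def by fastforce
  have odd: "f (z (Suc (Suc j))) (z (Suc j)) = z j" if "odd j" "j < n" for j
    using z that unfolding twist_coloring_def crossing_rel_def by fastforce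
  consider "i = 0" | "i = 1" | k where "i = Suc (Suc k)"
    by (metis One_nat_def not0_implies_Suc)
  then show ?case
  proof cases
    case 1
    have "right_div Q f (z 0) (z 0) = z 0"
      by (intro iffD2[OF right_div_eq_iff[OF Q]] quandle_idem[OF Q] mem) simp_all
    then show ?thesis
      using even[of 0] less.prems 1 by (simp add: twist_step_def)
  next
    case 2
    \<comment> \<open>The relation \<open>z 3 * z 2 = z 1\<close> determines \<open>z 3\<close>, and the image of \<open>z 1\<close> satisfies it as well.\<close>
    let ?u = "right_div Q f (z 1) (z 0)"
    have mem01: "z 0 \<in> Q" "z 1 \<in> Q"
      by (auto intro: mem)
    have u: "?u \<in> Q" "f ?u (z 0) = z 1"
      using right_div_closed[OF Q mem01(2,1)] right_div_mult[OF Q mem01(2,1)] by simp_all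
    have two: "z 2 = f (z 0) (z 1)"
      using even[of 0] less.prems 2 by (simp add: numeral_2_eq_2)
    have "f (f ?u (z 1)) (z 2) = f (f ?u (z 0)) (z 1)"
      unfolding two by (rule quandle_distrib[OF Q u(1) mem01, symmetric])
    also have "\<dots> = z 1"
      using u(2) quandle_idem[OF Q mem01(2)] by simp
    also have "\<dots> = f (z 3) (z 2)"
      using odd[of 1] less.prems 2 by (simp add: numeral_2_eq_2 numeral_3_eq_3)
    finally have eq: "f (f ?u (z 1)) (z 2) = f (z 3) (z 2)" .
    have "z 3 \<in> Q" "z 2 \<in> Q"
      by (rule mem; use less.prems 2 in simp)+
    then have "f ?u (z 1) = z 3"
      by (rule quandle_cancel[OF Q quandle_closed[OF Q u(1) mem01(2)] _ _ eq])
    then show ?thesis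
      using 2 by (simp add: twist_step_def numeral_3_eq_3)
  next
    case (3 k)
    have k: "z k \<in> Q" "z (Suc k) \<in> Q" "z i \<in> Q" "z (Suc i) \<in> Q" "z (Suc (Suc i)) \<in> Q"
      using less.prems 3 by (auto intro: mem)
    have mem01: "z 0 \<in> Q" "z 1 \<in> Q"
      by (auto intro: mem)
    have IH: "z i = ?s (z k)" "z (Suc i) = ?s (z (Suc k))"
      using less.IH[of k] less.IH[of "Suc k"] less.prems 3 by auto
    note hom = twist_step_hom[OF Q mem01]
    show ?thesis
    proof (cases "even i")
      case True
      then have "z (Suc (Suc i)) = f (z i) (z (Suc i))" "z i = f (z k) (z (Suc k))"
        using even[of i] even[of k] less.prems 3 by auto
      then show ?thesis
        using hom[OF k(1,2)] IH by simp
    next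
      case False
      then have o: "f (z (Suc (Suc i))) (z (Suc i)) = z i" "f (z i) (z (Suc k)) = z k"
        using odd[of i] odd[of k] less.prems 3 by auto
      have "f (?s (z i)) (z (Suc i)) = z i"
        using hom[OF k(3,2)] o(2) IH by simp
      then show ?thesis
        using o(1) k twist_step_closed[OF Q mem01 k(3)] quandle_cancel[OF Q] by metis
    qed
  qed
qed

lemma twist_coloring_iterates:
  assumes "quandle Q f" "twist_coloring Q f True n z"
  shows "2 * j \<le> Suc n \<Longrightarrow> z (2 * j) = (twist_step Q f (z 0) (z 1) ^^ j) (z 0)"
    and "2 * j \<le> n \<Longrightarrow> z (Suc (2 * j)) = (twist_step Q f (z 0) (z 1) ^^ j) (z 1)"
  by (induction j) (use twist_coloring_step[OF assms] in auto)

text \<open>If the first two colors agree, then the translation fixes them and all colors agree.\<close>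

lemma twist_coloring_nonconstant:
  assumes "quandle Q f" "twist_coloring Q f True n z" "i \<le> Suc n" "z i \<noteq> z 0"
  shows "z 0 \<noteq> z 1"
proof
  assume eq: "z 0 = z 1"
  have "z 0 \<in> Q"
    using assms(2) by (simp add: twist_coloring_def)
  then have "twist_step Q f (z 0) (z 1) (z 0) = z 0"
    using assms(1) eq right_div_mult by (simp add: twist_step_def)
  then have "(twist_step Q f (z 0) (z 1) ^^ j) (z 0) = z 0" for j
    by (induction j) auto
  then show False
    using twist_coloring_iterates[OF assms(1,2), of "i div 2"] assms(3,4) eq
    by (cases "even i") (auto elim!: evenE oddE)
qed

section \<open>Enumeration of the small quandles generated by two elements\<close>

text \<open>Names for the elements of a quandle with at most seven elements. A type with seven
  constructors, and rows with seven entries indexed by it, let rewriting look up an entry in a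
  single step.\<close>

datatype point = P0 | P1 | P2 | P3 | P4 | P5 | P6

lemma UNIV_point: "UNIV = set [P0, P1, P2, P3, P4, P5, P6]"
  using point.exhaust by auto

datatype 'v row = Row 'v 'v 'v 'v 'v 'v 'v

fun entry :: "'v row \<Rightarrow> point \<Rightarrow> 'v" where
  "entry (Row a b c d e f g) P0 = a"
| "entry (Row a b c d e f g) P1 = b"
| "entry (Row a b c d e f g) P2 = c"
| "entry (Row a b c d e f g) P3 = d"
| "entry (Row a b c d e f g) P4 = e"
| "entry (Row a b c d e f g) P5 = f"
| "entry (Row a b c d e f g) P6 = g"

fun put :: "'v row \<Rightarrow> point \<Rightarrow> 'v \<Rightarrow> 'v row" where
  "put (Row a b c d e f g) P0 v = Row v b c d e f g"
| "put (Row a b c d e f g) P1 v = Row a v c d e f g"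
| "put (Row a b c d e f g) P2 v = Row a b v d e f g"
| "put (Row a b c d e f g) P3 v = Row a b c v e f g"
| "put (Row a b c d e f g) P4 v = Row a b c d v f g"
| "put (Row a b c d e f g) P5 v = Row a b c d e v g"
| "put (Row a b c d e f g) P6 v = Row a b c d e f v"

lemma entry_put: "entry (put r p v) q = (if q = p then v else entry r q)"
  by (cases r; cases p; cases q) simp_all

text \<open>What is known of the right multiplications by the first and by the second generator, each
  followed by its inverse, and for every named element a word that expresses it by the
  generators (empty for names that are still free). The flag \<open>False\<close> stands for the first
  generator, \<open>True\<close> for the second.\<close>

datatype table =
  Table "point option row" "point option row" "point option row" "point option row" "bool list row"

fun act :: "table \<Rightarrow> bool \<Rightarrow> point \<Rightarrow> point option" where
  "act (Table A A' B B' W) c = entry (if c then B else A)"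

fun unact :: "table \<Rightarrow> bool \<Rightarrow> point \<Rightarrow> point option" where
  "unact (Table A A' B B' W) c = entry (if c then B' else A')"

fun word :: "table \<Rightarrow> point \<Rightarrow> bool list" where
  "word (Table A A' B B' W) = entry W"

fun learn :: "table \<Rightarrow> bool \<Rightarrow> point \<Rightarrow> point \<Rightarrow> table" where
  "learn (Table A A' B B' W) c x y =
     (if c then Table A A' (put B x (Some y)) (put B' y (Some x)) W
      else Table (put A x (Some y)) (put A' y (Some x)) B B' W)"

fun set_word :: "table \<Rightarrow> point \<Rightarrow> bool list \<Rightarrow> table" where
  "set_word (Table A A' B B' W) p w = Table A A' B B' (put W p w)"

lemma table_simps:
  "act (learn T c x y) d u = (if d = c \<and> u = x then Some y else act T d u)"
  "unact (learn T c x y) d u = (if d = c \<and> u = y then Some x else unact T d u)"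
  "word (learn T c x y) = word T"
  "act (set_word T p w) = act T"
  "unact (set_word T p w) = unact T"
  "word (set_word T p w) q = (if q = p then w else word T q)"
  by (cases T; auto simp: entry_put)+

text \<open>A word is a left-normed product, its last factor first: \<open>c # w\<close> stands for the product of
  \<open>w\<close> with the generator \<open>c\<close>. Right multiplication by such a product is that by \<open>w\<close>, conjugated
  by that by \<open>c\<close>; hence the multiplications by the two generators determine the entire quandle.\<close>

fun mult_word :: "table \<Rightarrow> bool list \<Rightarrow> point \<Rightarrow> point option" where
  "mult_word T [] x = None"
| "mult_word T (c # w) x =
    (if w = [] then act T c x
     else case unact T c x of None \<Rightarrow> None | Some y \<Rightarrow>
       (case mult_word T w y of None \<Rightarrow> None | Some z \<Rightarrow> act T c z))"

text \<open>If \<open>q\<close> is the product of \<open>p\<close> and a generator, then the word of \<open>q\<close> and the word of \<open>p\<close>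
  extended by this generator denote the same element, so multiplications by them cannot differ.\<close>

definition clash :: "table \<Rightarrow> point list \<Rightarrow> bool" where
  "clash T N \<longleftrightarrow> list_ex (\<lambda>c. list_ex (\<lambda>p.
     case act T c p of None \<Rightarrow> False | Some q \<Rightarrow>
       if c # word T p = word T q then False
       else list_ex (\<lambda>x. case mult_word T (c # word T p) x of None \<Rightarrow> False | Some y \<Rightarrow>
         (case mult_word T (word T q) x of None \<Rightarrow> False | Some z \<Rightarrow> y \<noteq> z)) N) N) [False, True]"

fun first_gap :: "table \<Rightarrow> (bool \<times> point) list \<Rightarrow> (bool \<times> point) option" where
  "first_gap T [] = None"
| "first_gap T (e # es) =
    (case e of (c, x) \<Rightarrow> if act T c x = None then Some e else first_gap T es)"

text \<open>The translation along the row, as far as the table determines it.\<close>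

definition step :: "table \<Rightarrow> point \<Rightarrow> point option" where
  "step T x = (case unact T False x of None \<Rightarrow> None | Some y \<Rightarrow> act T True y)"

fun steps :: "table \<Rightarrow> nat \<Rightarrow> point \<Rightarrow> point option" where
  "steps T 0 x = Some x"
| "steps T (Suc j) x = (case steps T j x of None \<Rightarrow> None | Some y \<Rightarrow> step T y)"

text \<open>Whether the table leaves it open that the closing relation \<open>y * a = x\<close> holds; an unknown
  entry counts as open, so that a negative answer is always reliable.\<close>

definition may_close :: "table \<Rightarrow> point option \<Rightarrow> point option \<Rightarrow> bool" where
  "may_close T y x = (case y of None \<Rightarrow> True | Some y' \<Rightarrow> (case x of None \<Rightarrow> True | Some x' \<Rightarrow>
     (case act T False y' of None \<Rightarrow> True | Some v \<Rightarrow> v = x')))"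

text \<open>The modulus and the residues of the crossing numbers whose twist knot is colored by a
  quandle with \<open>m\<close> elements generated by the coloring. The modulus \<open>1\<close> without residues stands
  for sizes that do not occur.\<close>

definition twist_residues :: "nat \<Rightarrow> nat \<times> nat list" where
  "twist_residues m =
     (if m = 3 then (3, [0]) else if m = 4 then (4, [0, 3]) else if m = 5 then (10, [4, 6, 7, 9])
      else if m = 6 then (3, [0]) else if m = 7 then (14, [0, 3, 5, 6, 11, 12]) else (1, []))"

definition residue_ok :: "nat \<Rightarrow> nat \<Rightarrow> bool" where
  "residue_ok m c \<longleftrightarrow> (case twist_residues m of (k, rs) \<Rightarrow> c mod k \<in> set rs)"

definition residue_ok_periodic :: "nat \<Rightarrow> nat \<Rightarrow> nat \<Rightarrow> bool" where
  "residue_ok_periodic m P c \<longleftrightarrow> (case twist_residues m of (k, rs) \<Rightarrow> P mod k = 0 \<and> c mod k \<in> set rs)"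

text \<open>The pair of the first two colors returns after \<open>J\<close> applications of the translation, so the
  colors have period \<open>2 J\<close>; for each of the \<open>2 J\<close> residues of the crossing number \<open>n + 2\<close>,
  either the sequence does not close up or the residue is among the expected ones. A translation
  of seven elements that moves two points along orbits needs at most \<open>12\<close> applications to bring
  both back.\<close>

definition verdict :: "table \<Rightarrow> nat \<Rightarrow> bool" where
  "verdict T m \<longleftrightarrow> list_ex (\<lambda>J.
     if steps T J P0 = Some P0 then
       if steps T J P1 = Some P1 then
         list_all (\<lambda>j.
           (if may_close T (steps T j P1) (steps T j P0)
            then residue_ok_periodic m (2 * J) (2 * j + 2) else True) \<and>
           (if may_close T (steps T (Suc j) P0) (steps T j P1)
            then residue_ok_periodic m (2 * J) (2 * j + 3) else True)) [0..<J]
       else False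
     else False) [1..<13]"

text \<open>The list \<open>N\<close> contains the names in use and \<open>F\<close> the free ones. At the first product by a
  generator that the table does not know, the search branches over all values: an element named
  before (not yet taken as a value, since right multiplications are injective), or a new one,
  which receives the next free name.\<close>

fun search :: "nat \<Rightarrow> point list \<Rightarrow> point list \<Rightarrow> table \<Rightarrow> bool" where
  "search 0 N F T = False"
| "search (Suc k) N F T =
    (if clash T N then True
     else case first_gap T (List.product [False, True] N) of
       None \<Rightarrow> verdict T (length N)
     | Some (c, x) \<Rightarrow>
         list_all (\<lambda>y. if unact T c y = None then search k N F (learn T c x y) else True) N \<and>
         (case F of [] \<Rightarrow> True
          | y # F' \<Rightarrow> search k (N @ [y]) F' (set_word (learn T c x y) y (c # word T x))))"

definition start :: table where
  "start = Table
     (Row (Some P0) None None None None None None) (Row (Some P0) None None None None None None)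
     (Row None (Some P1) None None None None None) (Row None (Some P1) None None None None None)
     (Row [False] [True] [] [] [] [] [])"

locale two_generated =
  fixes Q :: "'a set" and f :: "'a \<Rightarrow> 'a \<Rightarrow> 'a" and a b :: 'a
  assumes quandle: "quandle Q f" and gens: "a \<in> Q" "b \<in> Q"
begin

definition gen :: "bool \<Rightarrow> 'a" where
  "gen c = (if c then b else a)"

fun val :: "bool list \<Rightarrow> 'a" where
  "val [] = a"
| "val (c # w) = (if w = [] then gen c else f (val w) (gen c))"

text \<open>The invariant of the search. Entries of the table have to be true, but none has to be
  present; this is what allows the same notion for the initial, the intermediate and the
  complete tables.\<close>

definition names :: "table \<Rightarrow> point set \<Rightarrow> (point \<Rightarrow> 'a) \<Rightarrow> bool" where
  "names T N h \<longleftrightarrow> inj_on h N \<and> h ` N \<subseteq> Q \<and> P0 \<in> N \<and> P1 \<in> N \<and> h P0 = a \<and> h P1 = b \<and>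
     (\<forall>c x y. act T c x = Some y \<longrightarrow> x \<in> N \<and> y \<in> N \<and> f (h x) (gen c) = h y) \<and>
     (\<forall>c x y. unact T c y = Some x \<longrightarrow> x \<in> N \<and> y \<in> N \<and> act T c x = Some y) \<and>
     (\<forall>p\<in>N. word T p \<noteq> [] \<and> val (word T p) = h p)"

lemma gen_closed: "gen c \<in> Q"
  using gens by (simp add: gen_def)

lemma val_closed: "val w \<in> Q"
  by (induction w) (auto simp: gens gen_closed quandle_closed[OF quandle])

lemma namesD:
  assumes "names T N h"
  shows names_inj: "x \<in> N \<Longrightarrow> y \<in> N \<Longrightarrow> h x = h y \<Longrightarrow> x = y"
    and names_closed: "x \<in> N \<Longrightarrow> h x \<in> Q"
    and names_act: "act T c x = Some y \<Longrightarrow> x \<in> N \<and> y \<in> N \<and> f (h x) (gen c) = h y"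
    and names_unact: "unact T c y = Some x \<Longrightarrow> x \<in> N \<and> y \<in> N \<and> act T c x = Some y"
    and names_word: "p \<in> N \<Longrightarrow> word T p \<noteq> [] \<and> val (word T p) = h p"
  using assms unfolding names_def inj_on_def by blast+

lemma mult_word_sound:
  assumes "names T N h" "mult_word T w x = Some y"
  shows "x \<in> N \<and> y \<in> N \<and> f (h x) (val w) = h y"
  using assms(2)
proof (induction w arbitrary: x y)
  case (Cons c w)
  show ?case
  proof (cases "w = []")
    case True
    then show ?thesis
      using Cons.prems names_act[OF assms(1)] by simp
  next
    case False
    then obtain u v where u: "unact T c x = Some u" and v: "mult_word T w u = Some v"
      and y: "act T c v = Some y"
      using Cons.prems by (auto split: option.splits)
    have x: "u \<in> N" "x \<in> N" "f (h u) (gen c) = h x"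
      using names_unact[OF assms(1) u] names_act[OF assms(1)] by blast+
    have uv: "v \<in> N" "f (h u) (val w) = h v"
      using Cons.IH[OF v] by blast+
    have vy: "y \<in> N" "f (h v) (gen c) = h y"
      using names_act[OF assms(1) y] by blast+
    have "f (f (h u) (val w)) (gen c) = f (f (h u) (gen c)) (f (val w) (gen c))"
      by (rule quandle_distrib[OF quandle names_closed[OF assms(1) x(1)] val_closed gen_closed])
    then show ?thesis
      using x uv vy False by simp
  qed
qed simp

lemma no_clash:
  assumes "names T (set N) h"
  shows "\<not> clash T N"
proof
  assume "clash T N"
  then obtain c p where "p \<in> set N" and 1: "case act T c p of None \<Rightarrow> False | Some q \<Rightarrow>
      if c # word T p = word T q then False
      else list_ex (\<lambda>x. case mult_word T (c # word T p) x of None \<Rightarrow> False | Some y \<Rightarrow>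
        (case mult_word T (word T q) x of None \<Rightarrow> False | Some z \<Rightarrow> y \<noteq> z)) N"
    unfolding clash_def list_ex_iff by blast
  from 1 obtain q where q: "act T c p = Some q" and 2: "list_ex (\<lambda>x.
      case mult_word T (c # word T p) x of None \<Rightarrow> False | Some y \<Rightarrow>
        (case mult_word T (word T q) x of None \<Rightarrow> False | Some z \<Rightarrow> y \<noteq> z)) N"
    by (cases "act T c p") (simp_all only: option.case split: if_split_asm)
  from 2 obtain x where 3: "case mult_word T (c # word T p) x of None \<Rightarrow> False | Some y \<Rightarrow>
        (case mult_word T (word T q) x of None \<Rightarrow> False | Some z \<Rightarrow> y \<noteq> z)"
    unfolding list_ex_iff by blast
  from 3 obtain y where y: "mult_word T (c # word T p) x = Some y"
    and 4: "case mult_word T (word T q) x of None \<Rightarrow> False | Some z \<Rightarrow> y \<noteq> z"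
    by (cases "mult_word T (c # word T p) x") (simp_all only: option.case)
  from 4 obtain z where z: "mult_word T (word T q) x = Some z" and "y \<noteq> z"
    by (cases "mult_word T (word T q) x") simp_all
  have "val (c # word T p) = h q" "val (word T q) = h q"
    using names_word[OF assms] names_act[OF assms q] by auto
  then have "h y = h z" "y \<in> set N" "z \<in> set N"
    using mult_word_sound[OF assms y] mult_word_sound[OF assms z] by auto
  then show False
    using names_inj[OF assms] \<open>y \<noteq> z\<close> by blast
qed

lemma names_learn:
  assumes T: "names T N h" and N: "x \<in> N" "y \<in> N"
    and new: "act T c x = None" and y: "f (h x) (gen c) = h y"
  shows "unact T c y = None" "names (learn T c x y) N h"
proof -
  show un: "unact T c y = None"
  proof (rule ccontr)
    assume "unact T c y \<noteq> None"
    then obtain u where "unact T c y = Some u" by blast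
    then have u: "u \<in> N" "act T c u = Some y"
      using names_unact[OF T] by blast+
    then have "f (h u) (gen c) = f (h x) (gen c)"
      using names_act[OF T] y by simp
    then have "h u = h x"
      using quandle_cancel[OF quandle] names_closed[OF T] u(1) N(1) gen_closed by blast
    then have "u = x"
      using names_inj[OF T u(1) N(1)] by blast
    then show False
      using u(2) new by simp
  qed
  have "act T d x' \<noteq> Some y'" if "d = c" "x' = x" for d x' y'
    using that new by simp
  then show "names (learn T c x y) N h"
    using T N y new un unfolding names_def table_simps by (auto split: if_splits)
qed

lemma names_new_point:
  assumes T: "names T N h" and x: "x \<in> N" and y: "y \<notin> N"
    and new: "act T c x = None" and v: "f (h x) (gen c) \<notin> h ` N"
  shows "names (set_word (learn T c x y) y (c # word T x)) (insert y N) (h(y := f (h x) (gen c)))"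
proof -
  let ?h = "h(y := f (h x) (gen c))" and ?T = "set_word (learn T c x y) y (c # word T x)"
  have same: "?h p = h p" if "p \<in> N" for p
    using that y by auto
  have "inj_on ?h (insert y N)"
    using T y v unfolding names_def by (auto simp: inj_on_def image_iff)
  moreover have "?h ` insert y N \<subseteq> Q"
    using names_closed[OF T] quandle_closed[OF quandle names_closed[OF T x] gen_closed] by auto
  moreover have "P0 \<in> N" "P1 \<in> N" "h P0 = a" "h P1 = b"
    using T unfolding names_def by auto
  moreover have "u \<in> insert y N \<and> w \<in> insert y N \<and> f (?h u) (gen d) = ?h w"
    if "act ?T d u = Some w" for d u w
    using that names_act[OF T, of d u w] x y same unfolding table_simps by (auto split: if_splits)
  moreover have "u \<in> insert y N \<and> w \<in> insert y N \<and> act ?T d u = Some w"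
    if "unact ?T d w = Some u" for d u w
    using that names_unact[OF T, of d w u] x y new unfolding table_simps by (auto split: if_splits)
  moreover have "word ?T p \<noteq> [] \<and> val (word ?T p) = ?h p" if "p \<in> insert y N" for p
    using that names_word[OF T] x y unfolding table_simps by auto
  ultimately show ?thesis
    using same unfolding names_def by (intro conjI) (simp_all del: fun_upd_apply)
qed

lemma first_gap_sound: "first_gap T es = Some (c, x) \<Longrightarrow> (c, x) \<in> set es \<and> act T c x = None"
  by (induction es) (auto split: if_splits)

text \<open>Follow the branch of the search which, at every gap, takes the value that the product has
  in \<open>Q\<close>. No clash occurs on it, so it ends in a table with an affirmative verdict. A new name
  is always available when one is needed, because seven names already exhaust \<open>Q\<close>.\<close>

lemma search_sound:
  assumes "finite Q" "card Q \<le> 7"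
    and "search k N F T" "names T (set N) h" "distinct (N @ F)" "set N \<union> set F = UNIV"
  shows "\<exists>T' N' h'. names T' (set N') h' \<and> distinct N' \<and> verdict T' (length N')"
  using assms(3-)
proof (induction k arbitrary: N F T h)
  case (Suc k)
  note T = Suc.prems(2)
  show ?case
  proof (cases "first_gap T (List.product [False, True] N)")
    case None
    then show ?thesis
      using Suc.prems no_clash[OF T] by auto
  next
    case (Some e)
    obtain c x where e: "e = (c, x)" by (cases e)
    have "(c, x) \<in> set (List.product [False, True] N) \<and> act T c x = None"
      using first_gap_sound Some e by blast
    then have x: "x \<in> set N" and new: "act T c x = None"
      by auto
    have known: "list_all (\<lambda>y. if unact T c y = None then search k N F (learn T c x y) else True) N"
      and fresh: "case F of [] \<Rightarrow> True
        | y # F' \<Rightarrow> search k (N @ [y]) F' (set_word (learn T c x y) y (c # word T x))"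
      using Suc.prems(1) no_clash[OF T] Some e by simp_all
    let ?v = "f (h x) (gen c)"
    show ?thesis
    proof (cases "?v \<in> h ` set N")
      case True
      then obtain y where y: "y \<in> set N" "?v = h y" by blast
      note learn = names_learn[OF T x y(1) new y(2)]
      have "search k N F (learn T c x y)"
        using known y(1) learn(1) by (auto simp: list_all_iff)
      then show ?thesis
        using Suc.IH learn(2) Suc.prems(3,4) by blast
    next
      case False
      show ?thesis
      proof (cases F)
        case Nil
        then have N: "set N = UNIV"
          using Suc.prems(4) by simp
        then have "inj h" "h ` UNIV \<subseteq> Q"
          using T unfolding names_def by auto
        moreover have "card (UNIV :: point set) = 7"
          unfolding UNIV_point by (subst distinct_card) simp_all
        ultimately have "h ` UNIV = Q"
          using assms(1,2) by (intro card_seteq) (simp_all add: card_image)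
        then show ?thesis
          using False N quandle_closed[OF quandle names_closed[OF T x] gen_closed] by auto
      next
        case (Cons y F')
        then have y: "y \<notin> set N"
          using Suc.prems(3) by auto
        have new': "names (set_word (learn T c x y) y (c # word T x)) (set (N @ [y])) (h(y := ?v))"
          using names_new_point[OF T x y new False] by simp
        have "search k (N @ [y]) F' (set_word (learn T c x y) y (c # word T x))"
          using fresh Cons by simp
        then show ?thesis
          by (rule Suc.IH[OF _ new']) (use Suc.prems(3,4) Cons y in auto)
      qed
    qed
  qed
qed simp

lemma steps_sound:
  assumes T: "names T N h" and "x \<in> N" "steps T j x = Some y"
  shows "y \<in> N \<and> (twist_step Q f a b ^^ j) (h x) = h y"
  using assms(3)
proof (induction j arbitrary: y)
  case 0
  then show ?case using assms(2) by simp
next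
  case (Suc j)
  then obtain u v where u: "steps T j x = Some u" and v: "unact T False u = Some v"
    and y: "act T True v = Some y"
    by (auto simp: step_def split: option.splits)
  have v': "v \<in> N" "u \<in> N" "f (h v) a = h u" and y': "y \<in> N" "f (h v) b = h y"
    using names_unact[OF T v] names_act[OF T, of False v u] names_act[OF T y]
    by (auto simp: gen_def)
  have "right_div Q f (h u) a = h v"
    by (rule iffD2[OF right_div_eq_iff[OF quandle names_closed[OF T v'(2)] gens(1)
          names_closed[OF T v'(1)]] v'(3)])
  then show ?case
    using Suc.IH[OF u] y' by (simp add: twist_step_def)
qed

lemma may_close_sound:
  assumes T: "names T N h"
    and "\<And>y x. Y = Some y \<Longrightarrow> X = Some x \<Longrightarrow> x \<in> N \<and> f (h y) a = h x"
  shows "may_close T Y X"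
proof -
  have eq: "v = x" if "Y = Some y" "X = Some x" "act T False y = Some v" for x y v
  proof -
    have "h v = h x" "v \<in> N" "x \<in> N"
      using assms(2)[OF that(1,2)] names_act[OF T that(3)] by (simp_all add: gen_def)
    then show ?thesis
      using names_inj[OF T] by blast
  qed
  show ?thesis
    unfolding may_close_def
    by (cases Y; cases X) (auto intro: eq split: option.split)
qed

lemma residue_ok_periodicD:
  assumes "residue_ok_periodic m P c" "[c' = c] (mod P)"
  shows "residue_ok m c'"
proof -
  obtain k rs where k: "twist_residues m = (k, rs)"
    by (cases "twist_residues m")
  then have "k dvd P" "c mod k \<in> set rs"
    using assms(1) by (auto simp: residue_ok_periodic_def)
  then have "c' mod k = c mod k"
    using assms(2) mod_mod_cancel[of k P] unfolding cong_def by metis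
  then show ?thesis
    using k \<open>c mod k \<in> set rs\<close> by (simp add: residue_ok_def)
qed

text \<open>Periodicity reduces the closing relation for \<open>n\<close> half-twists to that for the residue of
  \<open>n\<close> modulo \<open>2 J\<close>, which the verdict has examined.\<close>

lemma verdict_sound:
  assumes T: "names T N h" and verdict: "verdict T m"
    and z: "twist_coloring Q f True n z" "z 0 = a" "z 1 = b"
  shows "residue_ok m (n + 2)"
proof -
  let ?s = "twist_step Q f a b"
  let ?even = "\<lambda>J j. may_close T (steps T j P1) (steps T j P0) \<longrightarrow>
    residue_ok_periodic m (2 * J) (2 * j + 2)"
  let ?odd = "\<lambda>J j. may_close T (steps T (Suc j) P0) (steps T j P1) \<longrightarrow>
    residue_ok_periodic m (2 * J) (2 * j + 3)"
  have "\<exists>J\<in>set [1..<13]. steps T J P0 = Some P0 \<and> steps T J P1 = Some P1 \<and>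
      (\<forall>j\<in>set [0..<J]. ?even J j \<and> ?odd J j)"
    using verdict unfolding verdict_def list_ex_iff list_all_iff
    by (simp only: if_bool_eq_conj simp_thms) blast
  then obtain J where "J \<in> set [1..<13]" and J: "steps T J P0 = Some P0" "steps T J P1 = Some P1"
    and all: "\<And>j. j \<in> set [0..<J] \<Longrightarrow> ?even J j \<and> ?odd J j"
    by blast
  then have "J \<ge> 1" by simp
  have even: "residue_ok_periodic m (2 * J) (2 * j + 2)"
    if "j < J" "may_close T (steps T j P1) (steps T j P0)" for j
    using all[of j] that by simp
  have odd: "residue_ok_periodic m (2 * J) (2 * j + 3)"
    if "j < J" "may_close T (steps T (Suc j) P0) (steps T j P1)" for j
    using all[of j] that by (simp del: steps.simps)
  have P: "P0 \<in> N" "P1 \<in> N" "h P0 = a" "h P1 = b"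
    using T unfolding names_def by blast+
  have period: "(?s ^^ J) a = a" "(?s ^^ J) b = b"
    using steps_sound[OF T P(1) J(1)] steps_sound[OF T P(2) J(2)] P(3,4) by auto
  define j where "j = (n div 2) mod J"
  have j: "j < J" "[n div 2 = j] (mod J)"
    using \<open>J \<ge> 1\<close> by (auto simp: j_def cong_def)
  have double: "[2 * (n div 2) = 2 * j] (mod 2 * J)"
    using j(2) unfolding cong_def by (simp only: mult_mod_right[symmetric])
  have fold: "(?s ^^ (n div 2)) a = (?s ^^ j) a" "(?s ^^ (n div 2)) b = (?s ^^ j) b"
    unfolding j_def by (rule funpow_mod_eq[OF period(1), symmetric], rule funpow_mod_eq[OF period(2), symmetric])
  have close: "f (z (Suc n)) a = z n"
    using z(1,2) by (simp add: twist_coloring_def crossing_rel_def)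
  have iter: "2 * i \<le> Suc n \<Longrightarrow> z (2 * i) = (?s ^^ i) a" "2 * i \<le> n \<Longrightarrow> z (Suc (2 * i)) = (?s ^^ i) b" for i
    using twist_coloring_iterates[OF quandle z(1), of i] z(2,3) by auto
  show ?thesis
  proof (cases "even n")
    case True
    then have n: "n = 2 * (n div 2)" by simp
    have "f ((?s ^^ j) b) a = (?s ^^ j) a"
      using close iter[of "n div 2"] n fold by simp
    then have "may_close T (steps T j P1) (steps T j P0)"
      using steps_sound[OF T P(1)] steps_sound[OF T P(2)] P(3,4)
      by (intro may_close_sound[OF T]) metis
    then have "residue_ok_periodic m (2 * J) (2 * j + 2)"
      using even j(1) by blast
    moreover have "[2 * (n div 2) + 2 = 2 * j + 2] (mod 2 * J)"
      by (rule cong_add[OF double cong_refl])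
    ultimately have "residue_ok m (2 * (n div 2) + 2)"
      by (rule residue_ok_periodicD)
    then show ?thesis
      using n by simp
  next
    case False
    then have n: "n = Suc (2 * (n div 2))" by (metis odd_two_times_div_two_succ Suc_eq_plus1)
    have "f (?s ((?s ^^ j) a)) a = (?s ^^ j) b"
      using close iter(1)[of "Suc (n div 2)"] iter(2)[of "n div 2"] n fold by simp
    then have "may_close T (steps T (Suc j) P0) (steps T j P1)"
      using steps_sound[OF T P(1), of "Suc j"] steps_sound[OF T P(2)] P(3,4)
      by (intro may_close_sound[OF T]) (metis funpow.simps(2) o_apply)
    then have "residue_ok_periodic m (2 * J) (2 * j + 3)"
      using odd j(1) by blast
    moreover have "[2 * (n div 2) + 3 = 2 * j + 3] (mod 2 * J)"
      by (rule cong_add[OF double cong_refl])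
    ultimately have "residue_ok m (2 * (n div 2) + 3)"
      by (rule residue_ok_periodicD)
    moreover have "n + 2 = 2 * (n div 2) + 3"
      using n by linarith
    ultimately show ?thesis
      by (simp only:)
  qed
qed

lemma start_names:
  assumes "a \<noteq> b"
  shows "names start (set [P0, P1]) (\<lambda>p. if p = P0 then a else b)"
proof -
  have "act start c x = Some y \<longleftrightarrow> x = y \<and> x = (if c then P1 else P0)"
    "unact start c y = Some x \<longleftrightarrow> x = y \<and> x = (if c then P1 else P0)" for c x y
    by (cases x; cases y; simp add: start_def)+
  then show ?thesis
    using assms gens quandle_idem[OF quandle] unfolding names_def
    by (auto simp: gen_def start_def inj_on_def)
qed

end

text \<open>Evaluation of the search from the table in which only \<open>a * a = a\<close> and \<open>b * b = b\<close> are
  known. The depth \<open>13\<close> suffices, as there are two generators with seven products each, two of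
  which are known at the start, and one more call judges the complete table.\<close>

lemma search_complete: "search 13 [P0, P1] [P2, P3, P4, P5, P6] start"
  by code_simp

section \<open>The minimal order\<close>

text \<open>The number \<open>m\<close> is the order of the subquandle generated by the first two colors.\<close>

lemma small_twist_coloring:
  assumes Q: "quandle Q f" "finite Q" "card Q \<le> 7"
    and z: "twist_coloring Q f True n z" "i \<le> Suc n" "z i \<noteq> z 0"
  shows "\<exists>m\<le>card Q. residue_ok m (n + 2)"
proof -
  interpret two_generated Q f "z 0" "z 1"
    using Q(1) z(1) by unfold_locales (auto simp: twist_coloring_def)
  have "z 0 \<noteq> z 1"
    using twist_coloring_nonconstant[OF Q(1) z] .
  note names0 = start_names[OF this]
  have "\<exists>T N h. names T (set N) h \<and> distinct N \<and> verdict T (length N)"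
    by (rule search_sound[OF Q(2,3) search_complete names0])
      (simp_all only: set_append[symmetric] UNIV_point, simp_all)
  then obtain T N h where T: "names T (set N) h" "distinct N" "verdict T (length N)"
    by blast
  have "residue_ok (length N) (n + 2)"
    using verdict_sound[OF T(1,3) z(1)] by simp
  moreover have "length N = card (h ` set N)" "h ` set N \<subseteq> Q"
    using T(1,2) unfolding names_def by (auto simp: card_image distinct_card)
  ultimately show ?thesis
    using card_mono[OF Q(2)] by metis
qed

lemma colorable_by_small_quandle:
  assumes L: "twist_knot c L" "c \<ge> 3"
    and Q: "quandle Q f" "finite Q" "card Q \<le> 7" "colorable Q f L"
  shows "\<exists>m\<le>card Q. residue_ok m c"
proof -
  obtain d z i where z: "twist_coloring Q f d (c - 2) z" "i \<le> Suc (c - 2)" "z i \<noteq> z 0"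
    using colorable_iff_twist_coloring[OF L] Q(4) by blast
  have "\<exists>m\<le>card Q. residue_ok m (c - 2 + 2)"
  proof (cases d)
    case True
    then show ?thesis
      using small_twist_coloring[OF Q(1-3) _ z(2,3)] z(1) by simp
  next
    case False
    then have "twist_coloring Q (right_div Q f) True (c - 2) z"
      using z(1) twist_coloring_dual[OF Q(1)] by simp
    then show ?thesis
      using small_twist_coloring[OF quandle_dual[OF Q(1)] Q(2,3) _ z(2,3)] by blast
  qed
  moreover have "c - 2 + 2 = c"
    using L(2) by simp
  ultimately show ?thesis
    by (simp only:)
qed

lemma residue_ok_iff:
  "residue_ok m c \<longleftrightarrow> m = 3 \<and> c mod 3 = 0 \<or> m = 4 \<and> c mod 4 \<in> {0, 3} \<or>
     m = 5 \<and> c mod 10 \<in> {4, 6, 7, 9} \<or> m = 6 \<and> c mod 3 = 0 \<or>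
     m = 7 \<and> c mod 14 \<in> {0, 3, 5, 6, 11, 12}"
  by (auto simp: residue_ok_def twist_residues_def)

lemma gives_min_quandle_orderI:
  assumes L: "twist_knot c L" "c \<ge> 3"
    and Q: "quandle Q f" "finite Q" "colorable Q f L" "card Q \<le> 7"
    and "\<And>m. m < card Q \<Longrightarrow> \<not> residue_ok m c"
  shows "min_quandle_order L = card Q" "gives_min_quandle_order Q f L"
proof -
  show "min_quandle_order L = card Q"
    unfolding min_quandle_order_def
  proof (rule Least_equality)
    show "\<exists>(R :: nat set) g. quandle R g \<and> finite R \<and> colorable R g L \<and> card R = card Q"
      using colorable_by_naturals[OF Q(1-3)] .
    fix m assume "\<exists>(R :: nat set) g. quandle R g \<and> finite R \<and> colorable R g L \<and> card R = m"
    then obtain R :: "nat set" and g where "quandle R g" "finite R" "colorable R g L" "card R = m"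
      by blast
    then show "card Q \<le> m"
      using colorable_by_small_quandle[OF L, of R g] assms(7) Q(4)
      by (metis le_cases le_trans not_le)
  qed
  then show "gives_min_quandle_order Q f L"
    using Q by (simp add: gives_min_quandle_order_def)
qed

lemma affine_colorable:
  assumes "twist_knot c L" "c \<ge> 3"
    and "p > 1" "coprime k p" "coprime l p" "p dvd alexander_twist (c - 2) l k"
  shows "colorable (Zn_carrier p) (Zn_op p l k) L"
  using colorable_iff_twist_coloring[OF assms(1,2)] affine_twist_coloring[OF assms(3-6)] by blast

text \<open>At \<open>t = - 1\<close> the Alexander polynomial is the determinant, here \<open>2 c - 3\<close>.\<close>

lemma alexander_twist_determinant: "alexander_twist n 1 1 = 2 * int n + 1"
  by (cases "even n") (auto simp: alexander_twist_def elim!: evenE oddE)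

text \<open>The dihedral quandle whose order is the determinant colors the knot; hence a finite
  coloring quandle exists, and the least order is attained.\<close>

lemma min_quandle_order_ge_8:
  assumes L: "twist_knot c L" "c \<ge> 3" and "\<And>m. \<not> residue_ok m c"
  shows "min_quandle_order L \<ge> 8"
proof -
  let ?P = "\<lambda>m. \<exists>(Q :: nat set) f. quandle Q f \<and> finite Q \<and> colorable Q f L \<and> card Q = m"
  define p where "p = 2 * int c - 3"
  have p: "p > 1" "p > 0" using L(2) by (simp_all add: p_def)
  have "p dvd alexander_twist (c - 2) 1 1"
    using alexander_twist_determinant[of "c - 2"] L(2) by (simp add: p_def of_nat_diff)
  then have col: "colorable (Zn_carrier p) (Zn_op p 1 1) L"
    by (intro affine_colorable[OF L p(1)]) simp_all
  have "quandle (Zn_carrier p) (Zn_op p 1 1)"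
    by (intro quandle_Zn p) simp_all
  from colorable_by_naturals[OF this finite_Zn col] have "\<exists>m. ?P m"
    by blast
  then have "?P (min_quandle_order L)"
    unfolding min_quandle_order_def by (rule LeastI_ex)
  then obtain Q :: "nat set" and f where "quandle Q f" "finite Q" "colorable Q f L"
    "card Q = min_quandle_order L"
    by blast
  then show ?thesis
    using colorable_by_small_quandle[OF L, of Q f] assms(3) by (cases "card Q \<le> 7") auto
qed

text \<open>The translation along the row has order \<open>p\<close> modulo \<open>p\<close>, so only the residue of \<open>n\<close> modulo
  \<open>2 p\<close> matters.\<close>

lemma alexander_twist_mod:
  "int p dvd alexander_twist n l k \<longleftrightarrow> int p dvd alexander_twist (n mod (2 * p)) l k"
proof -
  let ?q = "n div (2 * p)" and ?r = "n mod (2 * p)"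
  have n: "n = 2 * (p * ?q) + ?r"
    by (simp only: mult_div_mod_eq mult.assoc[symmetric])
  have "n div 2 = p * ?q + ?r div 2" "even n \<longleftrightarrow> even ?r"
    by (subst n, simp)+
  then have "alexander_twist n l k = int p * ((l + k)\<^sup>2 * int ?q) + alexander_twist ?r l k"
    by (simp add: alexander_twist_def algebra_simps)
  then show ?thesis
    by (simp add: dvd_add_right_iff)
qed

text \<open>The residue classes of the crossing number \<open>n + 2\<close>, split according to the affine quandle
  that realizes them.\<close>

lemma alexander_twist_roots:
  "(n + 2) mod 3 = 0 \<Longrightarrow> 3 dvd alexander_twist n 1 1"
  "(n + 2) mod 10 \<in> {4, 9} \<Longrightarrow> 5 dvd alexander_twist n 1 1"
  "(n + 2) mod 10 \<in> {6, 7} \<Longrightarrow> 5 dvd alexander_twist n 1 2"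
  "(n + 2) mod 14 \<in> {5, 12} \<Longrightarrow> 7 dvd alexander_twist n 1 1"
  "(n + 2) mod 14 \<in> {0, 3} \<Longrightarrow> 7 dvd alexander_twist n 1 2"
  "(n + 2) mod 14 \<in> {6, 11} \<Longrightarrow> 7 dvd alexander_twist n 1 3"
proof -
  have residue: "n mod 6 \<in> {1, 4}" if "(n + 2) mod 3 = 0"
    using that unfolding insert_iff empty_iff by presburger
  have residue5: "n mod 10 \<in> {2, 7}" if "(n + 2) mod 10 \<in> {4, 9}"
    using that unfolding insert_iff empty_iff by presburger
  have residue5': "n mod 10 \<in> {4, 5}" if "(n + 2) mod 10 \<in> {6, 7}"
    using that unfolding insert_iff empty_iff by presburger
  have residue7: "n mod 14 \<in> {3, 10}" if "(n + 2) mod 14 \<in> {5, 12}"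
    using that unfolding insert_iff empty_iff by presburger
  have residue7': "n mod 14 \<in> {1, 12}" if "(n + 2) mod 14 \<in> {0, 3}"
    using that unfolding insert_iff empty_iff by presburger
  have residue7'': "n mod 14 \<in> {4, 9}" if "(n + 2) mod 14 \<in> {6, 11}"
    using that unfolding insert_iff empty_iff by presburger
  show "(n + 2) mod 3 = 0 \<Longrightarrow> 3 dvd alexander_twist n 1 1"
    using residue alexander_twist_mod[of 3 n] by (auto simp: alexander_twist_def)
  show "(n + 2) mod 10 \<in> {4, 9} \<Longrightarrow> 5 dvd alexander_twist n 1 1"
    using residue5 alexander_twist_mod[of 5 n] by (auto simp: alexander_twist_def)
  show "(n + 2) mod 10 \<in> {6, 7} \<Longrightarrow> 5 dvd alexander_twist n 1 2"
    using residue5' alexander_twist_mod[of 5 n] by (auto simp: alexander_twist_def)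
  show "(n + 2) mod 14 \<in> {5, 12} \<Longrightarrow> 7 dvd alexander_twist n 1 1"
    using residue7 alexander_twist_mod[of 7 n] by (auto simp: alexander_twist_def)
  show "(n + 2) mod 14 \<in> {0, 3} \<Longrightarrow> 7 dvd alexander_twist n 1 2"
    using residue7' alexander_twist_mod[of 7 n] by (auto simp: alexander_twist_def)
  show "(n + 2) mod 14 \<in> {6, 11} \<Longrightarrow> 7 dvd alexander_twist n 1 3"
    using residue7'' alexander_twist_mod[of 7 n] by (auto simp: alexander_twist_def)
qed

section \<open>Arithmetic of the exceptional residues\<close>

text \<open>The exceptional pairs are those for which the smaller moduli \<open>3\<close> and \<open>4\<close> (and \<open>10\<close>, for
  order seven) do not already yield a smaller quandle; the classes modulo \<open>60 = lcm (3, 4, 10)\<close>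
  and \<open>420 = lcm (3, 4, 10, 14)\<close> are gone through one by one.\<close>

lemma residues5_check:
  "list_all (\<lambda>r. list_all (\<lambda>s. (r, s) \<in> residues5 \<longleftrightarrow>
     (10 * r + s) mod 3 \<noteq> 0 \<and> (10 * r + s) mod 4 \<notin> {0, 3}) [4, 6, 7, 9]) [0..<6]"
  by code_simp

lemma residues7_check:
  "list_all (\<lambda>r. list_all (\<lambda>s. (r, s) \<in> residues7 \<longleftrightarrow>
     (14 * r + s) mod 3 \<noteq> 0 \<and> (14 * r + s) mod 4 \<notin> {0, 3} \<and>
     (14 * r + s) mod 10 \<notin> {4, 6, 7, 9}) [0, 3, 5, 6, 11, 12]) [0..<30]"
  by code_simp

lemma residues_range:
  "(r, s) \<in> residues5 \<Longrightarrow> r \<in> set [0..<6] \<and> s \<in> set [4, 6, 7, 9]"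
  "(r, s) \<in> residues7 \<Longrightarrow> r \<in> set [0..<30] \<and> s \<in> set [0, 3, 5, 6, 11, 12]"
  unfolding residues5_def residues7_def by (elim UnE SigmaE2 insertE emptyE; simp)+

lemma residues4_iff:
  "(\<exists>q r. c = 12 * q + r \<and> r \<in> {4, 7, 8, 11}) \<longleftrightarrow> c mod 3 \<noteq> 0 \<and> c mod 4 \<in> {0, 3}" for c :: nat
proof
  assume c: "c mod 3 \<noteq> 0 \<and> c mod 4 \<in> {0, 3}"
  have "c = 12 * (c div 12) + c mod 12"
    by simp
  moreover have "c mod 12 \<in> {4, 7, 8, 11}"
    using c unfolding insert_iff empty_iff by presburger
  ultimately show "\<exists>q r. c = 12 * q + r \<and> r \<in> {4, 7, 8, 11}"
    by blast
next
  assume "\<exists>q r. c = 12 * q + r \<and> r \<in> {4, 7, 8, 11}"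
  then show "c mod 3 \<noteq> 0 \<and> c mod 4 \<in> {0, 3}"
    unfolding insert_iff empty_iff by presburger
qed

lemma mod_add_multiple:
  fixes x q M k :: nat
  assumes "k dvd M"
  shows "(x + q * M) mod k = x mod k"
  using assms by (auto simp: mult.left_commute[of q])

lemma residues5_iff:
  "(\<exists>q r s. c = 10 * (6 * q + r) + s \<and> (r, s) \<in> residues5) \<longleftrightarrow>
     c mod 3 \<noteq> 0 \<and> c mod 4 \<notin> {0, 3} \<and> c mod 10 \<in> {4, 6, 7, 9}" for c :: nat
proof -
  have digits: "c mod 3 = (10 * r + s) mod 3" "c mod 4 = (10 * r + s) mod 4" "c mod 10 = s mod 10"
    if "c = 10 * (6 * q + r) + s" for q r s
  proof -
    have c: "c = (10 * r + s) + q * 60" "c = s + (6 * q + r) * 10"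
      using that by simp_all
    show "c mod 3 = (10 * r + s) mod 3" "c mod 4 = (10 * r + s) mod 4"
      unfolding c(1) by (rule mod_add_multiple; simp)+
    show "c mod 10 = s mod 10"
      unfolding c(2) by (rule mod_add_multiple) simp
  qed
  have check: "(r, s) \<in> residues5 \<longleftrightarrow> (10 * r + s) mod 3 \<noteq> 0 \<and> (10 * r + s) mod 4 \<notin> {0, 3}"
    if "r \<in> set [0..<6]" "s \<in> set [4, 6, 7, 9]" for r s
    by (rule residues5_check[unfolded list_all_iff, rule_format, OF that])
  show ?thesis
  proof
    assume "\<exists>q r s. c = 10 * (6 * q + r) + s \<and> (r, s) \<in> residues5"
    then obtain q r s where c: "c = 10 * (6 * q + r) + s" and rs: "(r, s) \<in> residues5"
      by blast
    note range = residues_range(1)[OF rs]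
    have smod: "s mod 10 \<in> {4, 6, 7, 9}"
      using range by auto
    then show "c mod 3 \<noteq> 0 \<and> c mod 4 \<notin> {0, 3} \<and> c mod 10 \<in> {4, 6, 7, 9}"
      unfolding digits[OF c] using rs check range smod by metis
  next
    assume c: "c mod 3 \<noteq> 0 \<and> c mod 4 \<notin> {0, 3} \<and> c mod 10 \<in> {4, 6, 7, 9}"
    define q r s where "q = c div 10 div 6" and "r = c div 10 mod 6" and "s = c mod 10"
    have eq: "c = 10 * (6 * q + r) + s"
      unfolding q_def r_def s_def by (simp only: mult_div_mod_eq)
    have "r \<in> set [0..<6]" "s \<in> set [4, 6, 7, 9]"
      using c by (simp_all add: r_def s_def)
    then have "(r, s) \<in> residues5"
      using check c unfolding digits[OF eq] by metis
    then show "\<exists>q r s. c = 10 * (6 * q + r) + s \<and> (r, s) \<in> residues5"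
      using eq by blast
  qed
qed

lemma residues7_iff:
  "(\<exists>q r s. c = 14 * (30 * q + r) + s \<and> (r, s) \<in> residues7) \<longleftrightarrow>
     c mod 3 \<noteq> 0 \<and> c mod 4 \<notin> {0, 3} \<and> c mod 10 \<notin> {4, 6, 7, 9} \<and>
     c mod 14 \<in> {0, 3, 5, 6, 11, 12}" for c :: nat
proof -
  have digits: "c mod 3 = (14 * r + s) mod 3" "c mod 4 = (14 * r + s) mod 4"
    "c mod 10 = (14 * r + s) mod 10" "c mod 14 = s mod 14"
    if "c = 14 * (30 * q + r) + s" for q r s
  proof -
    have c: "c = (14 * r + s) + q * 420" "c = s + (30 * q + r) * 14"
      using that by simp_all
    show "c mod 3 = (14 * r + s) mod 3" "c mod 4 = (14 * r + s) mod 4"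
      "c mod 10 = (14 * r + s) mod 10"
      unfolding c(1) by (rule mod_add_multiple; simp)+
    show "c mod 14 = s mod 14"
      unfolding c(2) by (rule mod_add_multiple) simp
  qed
  have check: "(r, s) \<in> residues7 \<longleftrightarrow> (14 * r + s) mod 3 \<noteq> 0 \<and> (14 * r + s) mod 4 \<notin> {0, 3} \<and>
      (14 * r + s) mod 10 \<notin> {4, 6, 7, 9}"
    if "r \<in> set [0..<30]" "s \<in> set [0, 3, 5, 6, 11, 12]" for r s
    by (rule residues7_check[unfolded list_all_iff, rule_format, OF that])
  show ?thesis
  proof
    assume "\<exists>q r s. c = 14 * (30 * q + r) + s \<and> (r, s) \<in> residues7"
    then obtain q r s where c: "c = 14 * (30 * q + r) + s" and rs: "(r, s) \<in> residues7"
      by blast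
    note range = residues_range(2)[OF rs]
    have smod: "s mod 14 \<in> {0, 3, 5, 6, 11, 12}"
      using range by auto
    then show "c mod 3 \<noteq> 0 \<and> c mod 4 \<notin> {0, 3} \<and> c mod 10 \<notin> {4, 6, 7, 9} \<and>
      c mod 14 \<in> {0, 3, 5, 6, 11, 12}"
      unfolding digits[OF c] using rs check range smod by metis
  next
    assume c: "c mod 3 \<noteq> 0 \<and> c mod 4 \<notin> {0, 3} \<and> c mod 10 \<notin> {4, 6, 7, 9} \<and>
      c mod 14 \<in> {0, 3, 5, 6, 11, 12}"
    define q r s where "q = c div 14 div 30" and "r = c div 14 mod 30" and "s = c mod 14"
    have eq: "c = 14 * (30 * q + r) + s"
      unfolding q_def r_def s_def by (simp only: mult_div_mod_eq)
    have "r \<in> set [0..<30]" "s \<in> set [0, 3, 5, 6, 11, 12]"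
      using c by (simp_all add: r_def s_def)
    then have "(r, s) \<in> residues7"
      using check c unfolding digits[OF eq] by metis
    then show "\<exists>q r s. c = 14 * (30 * q + r) + s \<and> (r, s) \<in> residues7"
      using eq by blast
  qed
qed

section \<open>Twist knots of minimal quandle order at most seven\<close>

lemma min_order_affine:
  assumes L: "twist_knot c L" "c \<ge> 3"
    and "1 < p" "p \<le> 7" "coprime k p" "coprime l p" "p dvd alexander_twist (c - 2) l k"
    and "\<And>m. m < nat p \<Longrightarrow> \<not> residue_ok m c"
  shows "min_quandle_order L = nat p" "gives_min_quandle_order (Zn_carrier p) (Zn_op p l k) L"
proof -
  have "quandle (Zn_carrier p) (Zn_op p l k)" "finite (Zn_carrier p)" "card (Zn_carrier p) \<le> 7"
    "colorable (Zn_carrier p) (Zn_op p l k) L"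
    using assms by (simp_all add: quandle_Zn finite_Zn card_Zn affine_colorable)
  with assms(8) show "min_quandle_order L = nat p"
    "gives_min_quandle_order (Zn_carrier p) (Zn_op p l k) L"
    using gives_min_quandle_orderI[OF L, of "Zn_carrier p" "Zn_op p l k"] by (simp_all add: card_Zn)
qed

theorem theorem1p4:
  fixes c :: nat and L :: "twist_edge ocrossing list"
  assumes "c \<ge> 3" and "twist_knot c L"
  shows
    "(min_quandle_order L = 3 \<longleftrightarrow> [c = 0] (mod 3)) \<and>
     (min_quandle_order L = 3 \<longrightarrow>
        gives_min_quandle_order (Zn_carrier 3) (Zn_op 3 1 1) L) \<and>
     (min_quandle_order L = 4 \<longleftrightarrow> (\<exists>q r. c = 12 * q + r \<and> r \<in> {4, 7, 8, 11})) \<and>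
     (min_quandle_order L = 4 \<longrightarrow>
        gives_min_quandle_order S4_carrier S4_op L) \<and>
     (min_quandle_order L = 5 \<longleftrightarrow>
        (\<exists>q r s. c = 10 * (6 * q + r) + s \<and> (r, s) \<in> residues5)) \<and>
     (\<forall>q r s. c = 10 * (6 * q + r) + s \<and> (r, s) \<in> residues5 \<longrightarrow>
        (s \<in> {4, 9} \<longrightarrow> gives_min_quandle_order (Zn_carrier 5) (Zn_op 5 1 1) L) \<and>
        (s \<in> {6, 7} \<longrightarrow> gives_min_quandle_order (Zn_carrier 5) (Zn_op 5 1 2) L)) \<and>
     (min_quandle_order L = 7 \<longleftrightarrow>
        (\<exists>q r s. c = 14 * (30 * q + r) + s \<and> (r, s) \<in> residues7)) \<and>
     (\<forall>q r s. c = 14 * (30 * q + r) + s \<and> (r, s) \<in> residues7 \<longrightarrow>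
        (s \<in> {5, 12} \<longrightarrow> gives_min_quandle_order (Zn_carrier 7) (Zn_op 7 1 1) L) \<and>
        (s \<in> {0, 3} \<longrightarrow> gives_min_quandle_order (Zn_carrier 7) (Zn_op 7 1 2) L) \<and>
        (s \<in> {6, 11} \<longrightarrow> gives_min_quandle_order (Zn_carrier 7) (Zn_op 7 1 3) L)) \<and>
     (\<not> [c = 0] (mod 3) \<and>
      \<not> (\<exists>q r. c = 12 * q + r \<and> r \<in> {4, 7, 8, 11}) \<and>
      \<not> (\<exists>q r s. c = 10 * (6 * q + r) + s \<and> (r, s) \<in> residues5) \<and>
      \<not> (\<exists>q r s. c = 14 * (30 * q + r) + s \<and> (r, s) \<in> residues7) \<longrightarrow>
        min_quandle_order L \<ge> 8)"
proof -
  note L = assms(2,1)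
  let ?A = "c mod 3 = 0" and ?B = "c mod 4 \<in> {0, 3}" and ?C = "c mod 10 \<in> {4, 6, 7, 9}"
    and ?D = "c mod 14 \<in> {0, 3, 5, 6, 11, 12}"
  have c: "c - 2 + 2 = c"
    using assms(1) by simp
  note roots = alexander_twist_roots[of "c - 2", unfolded c]
  have coprimes: "coprime 2 (5::int)" "coprime 2 (7::int)" "coprime 3 (7::int)"
    by (simp_all add: coprime_iff_gcd_eq_1 gcd_non_0_int)
  have three: "min_quandle_order L = 3 \<and> gives_min_quandle_order (Zn_carrier 3) (Zn_op 3 1 1) L" if ?A
    using min_order_affine[OF L, of 3 1 1] roots(1)[OF that] by (simp add: residue_ok_iff)
  have four: "min_quandle_order L = 4 \<and> gives_min_quandle_order S4_carrier S4_op L" if "\<not> ?A" ?B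
  proof -
    have "n mod 4 \<in> {1, 2}" if "(n + 2) mod 4 \<in> {0, 3}" for n :: nat
      using that unfolding insert_iff empty_iff by presburger
    from this[of "c - 2", unfolded c, OF that(2)] have "(c - 2) mod 4 \<in> {1, 2}" .
    then have "colorable S4_carrier S4_op L"
      using colorable_iff_twist_coloring[OF L] tetrahedron_twist_coloring by blast
    then show ?thesis
      using gives_min_quandle_orderI[OF L quandle_S4 finite_S4] that(1)
      by (simp add: card_S4 residue_ok_iff)
  qed
  have five: "min_quandle_order L = 5"
      "c mod 10 \<in> {4, 9} \<Longrightarrow> gives_min_quandle_order (Zn_carrier 5) (Zn_op 5 1 1) L"
      "c mod 10 \<in> {6, 7} \<Longrightarrow> gives_min_quandle_order (Zn_carrier 5) (Zn_op 5 1 2) L"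
    if "\<not> ?A" "\<not> ?B" ?C
  proof -
    have no: "\<not> residue_ok m c" if "m < nat 5" for m
      using that \<open>\<not> ?A\<close> \<open>\<not> ?B\<close> by (auto simp: residue_ok_iff)
    have 1: "min_quandle_order L = 5 \<and> gives_min_quandle_order (Zn_carrier 5) (Zn_op 5 1 1) L"
      if "c mod 10 \<in> {4, 9}"
      using min_order_affine[OF L, of 5 1 1, OF _ _ _ _ roots(2)[OF that] no] by simp
    have 2: "min_quandle_order L = 5 \<and> gives_min_quandle_order (Zn_carrier 5) (Zn_op 5 1 2) L"
      if "c mod 10 \<in> {6, 7}"
      using min_order_affine[OF L, of 5 2 1, OF _ _ coprimes(1) _ roots(3)[OF that] no] by simp
    show "min_quandle_order L = 5"
      using 1 2 \<open>?C\<close> by blast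
    show "c mod 10 \<in> {4, 9} \<Longrightarrow> gives_min_quandle_order (Zn_carrier 5) (Zn_op 5 1 1) L"
      "c mod 10 \<in> {6, 7} \<Longrightarrow> gives_min_quandle_order (Zn_carrier 5) (Zn_op 5 1 2) L"
      by (fact 1[THEN conjunct2] 2[THEN conjunct2])+
  qed
  have seven: "min_quandle_order L = 7"
      "c mod 14 \<in> {5, 12} \<Longrightarrow> gives_min_quandle_order (Zn_carrier 7) (Zn_op 7 1 1) L"
      "c mod 14 \<in> {0, 3} \<Longrightarrow> gives_min_quandle_order (Zn_carrier 7) (Zn_op 7 1 2) L"
      "c mod 14 \<in> {6, 11} \<Longrightarrow> gives_min_quandle_order (Zn_carrier 7) (Zn_op 7 1 3) L"
    if "\<not> ?A" "\<not> ?B" "\<not> ?C" ?D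
  proof -
    have no: "\<not> residue_ok m c" if "m < nat 7" for m
      using that \<open>\<not> ?A\<close> \<open>\<not> ?B\<close> \<open>\<not> ?C\<close> by (auto simp: residue_ok_iff)
    have 1: "min_quandle_order L = 7 \<and> gives_min_quandle_order (Zn_carrier 7) (Zn_op 7 1 1) L"
      if "c mod 14 \<in> {5, 12}"
      using min_order_affine[OF L, of 7 1 1, OF _ _ _ _ roots(4)[OF that] no] by simp
    have 2: "min_quandle_order L = 7 \<and> gives_min_quandle_order (Zn_carrier 7) (Zn_op 7 1 2) L"
      if "c mod 14 \<in> {0, 3}"
      using min_order_affine[OF L, of 7 2 1, OF _ _ coprimes(2) _ roots(5)[OF that] no] by simp
    have 3: "min_quandle_order L = 7 \<and> gives_min_quandle_order (Zn_carrier 7) (Zn_op 7 1 3) L"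
      if "c mod 14 \<in> {6, 11}"
      using min_order_affine[OF L, of 7 3 1, OF _ _ coprimes(3) _ roots(6)[OF that] no] by simp
    show "min_quandle_order L = 7"
      using 1 2 3 \<open>?D\<close> by blast
    show "c mod 14 \<in> {5, 12} \<Longrightarrow> gives_min_quandle_order (Zn_carrier 7) (Zn_op 7 1 1) L"
      "c mod 14 \<in> {0, 3} \<Longrightarrow> gives_min_quandle_order (Zn_carrier 7) (Zn_op 7 1 2) L"
      "c mod 14 \<in> {6, 11} \<Longrightarrow> gives_min_quandle_order (Zn_carrier 7) (Zn_op 7 1 3) L"
      by (fact 1[THEN conjunct2] 2[THEN conjunct2] 3[THEN conjunct2])+
  qed
  have eight: "min_quandle_order L \<ge> 8" if "\<not> ?A" "\<not> ?B" "\<not> ?C" "\<not> ?D"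
    using that by (intro min_quandle_order_ge_8[OF L]) (simp add: residue_ok_iff)
  have A: "[c = 0] (mod 3) \<longleftrightarrow> ?A"
    by (simp add: cong_def)
  have s5: "s = c mod 10" if "c = 10 * (6 * q + r) + s" "(r, s) \<in> residues5" for q r s
  proof -
    have "c = s + (6 * q + r) * 10" "s < 10"
      using that(1) residues_range(1)[OF that(2)] by auto
    then show ?thesis
      using mod_add_multiple[of 10 10 s "6 * q + r"] by simp
  qed
  have s7: "s = c mod 14" if "c = 14 * (30 * q + r) + s" "(r, s) \<in> residues7" for q r s
  proof -
    have "c = s + (30 * q + r) * 14" "s < 14"
      using that(1) residues_range(2)[OF that(2)] by auto
    then show ?thesis
      using mod_add_multiple[of 14 14 s "30 * q + r"] by simp
  qed
  have give5: "\<forall>q r s. c = 10 * (6 * q + r) + s \<and> (r, s) \<in> residues5 \<longrightarrow>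
      (s \<in> {4, 9} \<longrightarrow> gives_min_quandle_order (Zn_carrier 5) (Zn_op 5 1 1) L) \<and>
      (s \<in> {6, 7} \<longrightarrow> gives_min_quandle_order (Zn_carrier 5) (Zn_op 5 1 2) L)"
  proof (intro allI impI)
    fix q r s assume h: "c = 10 * (6 * q + r) + s \<and> (r, s) \<in> residues5"
    then have "\<not> ?A \<and> \<not> ?B \<and> ?C"
      by (intro iffD1[OF residues5_iff[of c]]) blast
    then have "\<not> ?A" "\<not> ?B" ?C
      by simp_all
    from five(2,3)[OF this] s5[OF conjunct1[OF h] conjunct2[OF h]]
    show "(s \<in> {4, 9} \<longrightarrow> gives_min_quandle_order (Zn_carrier 5) (Zn_op 5 1 1) L) \<and>
      (s \<in> {6, 7} \<longrightarrow> gives_min_quandle_order (Zn_carrier 5) (Zn_op 5 1 2) L)"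
      by simp
  qed
  have give7: "\<forall>q r s. c = 14 * (30 * q + r) + s \<and> (r, s) \<in> residues7 \<longrightarrow>
      (s \<in> {5, 12} \<longrightarrow> gives_min_quandle_order (Zn_carrier 7) (Zn_op 7 1 1) L) \<and>
      (s \<in> {0, 3} \<longrightarrow> gives_min_quandle_order (Zn_carrier 7) (Zn_op 7 1 2) L) \<and>
      (s \<in> {6, 11} \<longrightarrow> gives_min_quandle_order (Zn_carrier 7) (Zn_op 7 1 3) L)"
  proof (intro allI impI)
    fix q r s assume h: "c = 14 * (30 * q + r) + s \<and> (r, s) \<in> residues7"
    then have "\<not> ?A \<and> \<not> ?B \<and> \<not> ?C \<and> ?D"
      by (intro iffD1[OF residues7_iff[of c]]) blast
    then have "\<not> ?A" "\<not> ?B" "\<not> ?C" ?D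
      by simp_all
    from seven(2-4)[OF this] s7[OF conjunct1[OF h] conjunct2[OF h]]
    show "(s \<in> {5, 12} \<longrightarrow> gives_min_quandle_order (Zn_carrier 7) (Zn_op 7 1 1) L) \<and>
      (s \<in> {0, 3} \<longrightarrow> gives_min_quandle_order (Zn_carrier 7) (Zn_op 7 1 2) L) \<and>
      (s \<in> {6, 11} \<longrightarrow> gives_min_quandle_order (Zn_carrier 7) (Zn_op 7 1 3) L)"
      by simp
  qed
  consider (three) ?A | (four) "\<not> ?A" ?B | (five) "\<not> ?A" "\<not> ?B" ?C
    | (seven) "\<not> ?A" "\<not> ?B" "\<not> ?C" ?D | (eight) "\<not> ?A" "\<not> ?B" "\<not> ?C" "\<not> ?D"
    by blast
  then show ?thesis
    unfolding A residues4_iff residues5_iff residues7_iff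
    using give5 give7
    by cases (use three four five(1) seven(1) eight in auto)
qed

end
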